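(* Let $n\ge 0$ be an integer and let $D$ be a fixed flat virtual knot diagram. Let $V=V_{flat}\cup V_{fake}$ and $V'=V_{flat}\cup V'_{fake}$ be two nonempty vertex sets of $D$ given by two choices of fake vertices, and let $A$ (of size $k$) and $A'$ (of size $k'$) be coloring matrices over $\mathcal{S}_n$ of $(D,V)$ and $(D,V')$ respectively, for some choices of starting arcs. Then there exist units $U,W\in\mathcal{S}_n$ with $\pi_{0,n}(UW)=1$ such that $|A'|_{k',k'}=U\,|A|_{k,k}\,W$. That is, for a fixed diagram, the $\mathcal{S}_n$-coloring invariant is independent of the choice of the fake vertices.
   Context: Ring. For a non-negative integer $n$, $\mathcal{S}_n$ is the unital ring $\mathbb{Z}\langle s,\overline{s},t\rangle/I_n$, where $I_n$ is the two-sided ideal generated by $s\overline{s}-1$, $\overline{s}s-1$, $ts-s\sum_{i=1}^{n}t^{i}$, $t\overline{s}-\overline{s}\sum_{i=1}^{n}(-1)^{i-1}t^{i}$ and $t^{n+1}$; the image of $\overline{s}$ is written $s^{-1}$. $\mathcal{S}_0=\mathbb{Z}[s^{\pm1}]$, and $\pi_{0,n}:\mathcal{S}_n\to\mathcal{S}_0$ is the ring homomorphism with $s\mapsto s$, $t\mapsto 0$. Quasideterminant. For an $m\times m$ matrix $A$ over a ring, let $A^{i,j}$ be $A$ with row $i$ and column $j$ deleted, $r_i^{j}(A)$ the $i$-th row with its $j$-th entry deleted, $c^{i}_{j}(A)$ the $j$-th column with its $i$-th entry deleted. If $m=1$, $|A|_{1,1}=(A)_{1,1}$. If $m>1$ and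 $A^{i,j}$ is invertible, $|A|_{i,j}=(A)_{i,j}-r_i^{j}(A)(A^{i,j})^{-1}c^{i}_{j}(A)$. For the coloring matrices below, $|A|_{k,k}$ is always defined. Diagrams. A flat virtual knot diagram is a generic immersion of an oriented circle $S^1$ into $\mathbb{R}^2$ (finitely many multiple points, all transversal double points), each double point being labeled "flat" or "virtual". $V_{flat}$ is the set of flat crossings, and $V_{fake}$ is a (possibly empty) finite set of points of the image that are not double points, called fake vertices; $V=V_{flat}\cup V_{fake}$ is assumed nonempty. The preimage of $V$ cuts $S^1$ into $k$ components, whose images are called the arcs of $(D,V)$ (virtual crossings do not cut arcs). Coloring matrix. Choose a starting arc, label it $1$, and label the other arcs $2,\dots,k$ in order along the orientation; the arc with index $0$ means arc $k$. Let $e_1,\dots,e_k$ be the standard row vectors. At each flat crossing with velocity vectors of its two strands $v_1,v_2$, name the strands so that $(v_1,v_2)$ is a positively oriented basis of $\mathbb{R}^2$. The $i$-th row of $A$ is determined by the vertex at the initial point of arc $i$: (a) if it is a flat crossing and arcs $i-1,i$ lie (before and after the crossing) on its strand 2, the row is $e_i-s\,e_{i-1}-t\,e_j$, where $j$ is the label of the arc entering the crossing along strand 1; (b) if it is a flat crossing and arcs $i-1,i$ lie on its strand 1, the row is $e_i-s^{-1}(1-t^2)\,e_{i-1}+s^{-1}ts\,e_j$, where $j$ is the label of the arc entering the crossing along strand 2; (c) if it is a fake vertex, the row is $e_i-e_{i-1}$ (zero if $k=1$). Coefficients are added when indices coincide. The $\mathcal{S}_n$-coloring invariant is the class of $|A|_{k,k}$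 under the equivalence relation $F\sim UFW$ for units $U,W\in\mathcal{S}_n$ with $\pi_{0,n}(UW)=1$. *)

theory Defs
  imports
    "HOL-Analysis.Analysis"
    "HOL-Algebra.QuotRing"
    "HOL-Library.Poly_Mapping"
begin

section \<open>The rings\<close>

datatype generator = Gen_s | Gen_sbar | Gen_t

text \<open>
  Words form the free monoid under concatenation, written additively because the convolution
  product of \<open>poly_mapping\<close> requires \<open>monoid_add\<close>. Hence \<open>word \<Rightarrow>\<^sub>0 int\<close> is the free unital ring
  \<open>\<int>\<langle>s, sbar, t\<rangle>\<close>.
\<close>

datatype word = Word (letters: "generator list")

instantiation word :: monoid_add
begin

definition zero_word :: word where "0 = Word []"

definition plus_word :: "word \<Rightarrow> word \<Rightarrow> word" where
  "v + w = Word (letters v @ letters w)"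

instance
  by standard (simp_all add: zero_word_def plus_word_def)

end

type_synonym free_alg = "word \<Rightarrow>\<^sub>0 int"

definition gen :: "generator \<Rightarrow> free_alg" where
  "gen x = Poly_Mapping.single (Word [x]) 1"

definition free_ring :: "free_alg ring" where
  "free_ring = \<lparr>carrier = UNIV, mult = (*), one = 1, zero = 0, add = (+)\<rparr>"

definition S_relators :: "nat \<Rightarrow> free_alg set" where
  "S_relators n =
    (let s = gen Gen_s; sb = gen Gen_sbar; t = gen Gen_t in
      {s * sb - 1,
       sb * s - 1,
       t * s - s * (\<Sum>i=1..n. t ^ i),
       t * sb - sb * (\<Sum>i=1..n. (-1) ^ (i - 1) * t ^ i),
       t ^ (n + 1)})"

definition S_ideal :: "nat \<Rightarrow> free_alg set" where
  "S_ideal n = genideal free_ring (S_relators n)"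

definition S_ring :: "nat \<Rightarrow> free_alg set ring" where
  "S_ring n = free_ring Quot (S_ideal n)"

definition S_class :: "nat \<Rightarrow> free_alg \<Rightarrow> free_alg set" where
  "S_class n x = S_ideal n +>\<^bsub>free_ring\<^esub> x"

definition s_elt :: "nat \<Rightarrow> free_alg set" where "s_elt n = S_class n (gen Gen_s)"
definition sinv_elt :: "nat \<Rightarrow> free_alg set" where "sinv_elt n = S_class n (gen Gen_sbar)"
definition t_elt :: "nat \<Rightarrow> free_alg set" where "t_elt n = S_class n (gen Gen_t)"

lemma ring_free_ring: "ring free_ring"
proof (rule ringI)
  show "abelian_group free_ring"
  proof (rule abelian_groupI)
    fix x :: free_alg
    show "\<exists>y\<in>carrier free_ring. y \<oplus>\<^bsub>free_ring\<^esub> x = \<zero>\<^bsub>free_ring\<^esub>"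
      by (rule bexI[of _ "- x"]) (simp_all add: free_ring_def)
  qed (simp_all add: free_ring_def algebra_simps)
  show "Group.monoid free_ring"
    by (rule monoidI) (simp_all add: free_ring_def algebra_simps)
qed (simp_all add: free_ring_def algebra_simps)

lemma ideal_S_ideal: "ideal (S_ideal n) free_ring"
  unfolding S_ideal_def by (rule ring.genideal_ideal[OF ring_free_ring]) (simp add: free_ring_def)

lemma ring_S_ring: "ring (S_ring n)"
  unfolding S_ring_def by (rule ideal.quotient_is_ring[OF ideal_S_ideal])

text \<open>
  The projection is determined only on the carrier, where it is unique because \<open>s\<close>, its inverse
  and \<open>t\<close> generate \<open>S_ring n\<close>; its existence is shown below.
\<close>

definition is_S_proj0 :: "nat \<Rightarrow> (free_alg set \<Rightarrow> free_alg set) \<Rightarrow> bool" where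
  "is_S_proj0 n p \<longleftrightarrow>
    p \<in> ring_hom (S_ring n) (S_ring 0) \<and> p (s_elt n) = s_elt 0 \<and> p (t_elt n) = \<zero>\<^bsub>S_ring 0\<^esub>"

definition S_proj0 :: "nat \<Rightarrow> free_alg set \<Rightarrow> free_alg set" where
  "S_proj0 n = (SOME p. is_S_proj0 n p)"

lemma S_ideal_subset_0: "S_ideal n \<subseteq> S_ideal 0"
proof -
  interpret I: ideal "S_ideal 0" free_ring by (rule ideal_S_ideal)
  define s sb t where "s = gen Gen_s" and "sb = gen Gen_sbar" and "t = gen Gen_t"
  have gens: "S_relators 0 \<subseteq> S_ideal 0"
    unfolding S_ideal_def by (rule ring.genideal_self[OF ring_free_ring]) (simp add: free_ring_def)
  have s1: "s * sb - 1 \<in> S_ideal 0" "sb * s - 1 \<in> S_ideal 0" and t: "t \<in> S_ideal 0"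
    using gens by (simp_all add: S_relators_def Let_def s_def sb_def t_def)
  have mr: "x * y \<in> S_ideal 0" if "x \<in> S_ideal 0" for x y
    using I.I_r_closed[OF that, of y] by (simp add: free_ring_def)
  have ml: "y * x \<in> S_ideal 0" if "x \<in> S_ideal 0" for x y
    using I.I_l_closed[OF that, of y] by (simp add: free_ring_def)
  have ad: "x + y \<in> S_ideal 0" if "x \<in> S_ideal 0" "y \<in> S_ideal 0" for x y
    using additive_subgroup.a_closed[OF ideal.axioms(1)[OF ideal_S_ideal[of 0]] that] by (simp add: free_ring_def)
  have zr: "0 \<in> S_ideal 0"
    using additive_subgroup.zero_closed[OF ideal.axioms(1)[OF ideal_S_ideal[of 0]]]
    by (simp add: free_ring_def)
  have mi: "x - y \<in> S_ideal 0" if "x \<in> S_ideal 0" "y \<in> S_ideal 0" for x y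
    using ad[OF that(1) ml[OF that(2), of "-1"]] by simp
  have tp: "t ^ i \<in> S_ideal 0" if "i \<ge> 1" for i
    using that mr[OF t] by (cases i) auto
  have sm: "(\<Sum>i=1..n. f i * t ^ i) \<in> S_ideal 0" for f
  proof -
    have "(\<Sum>i\<in>A. f i * t ^ i) \<in> S_ideal 0" if "finite A" "A \<subseteq> {1..}" for A :: "nat set"
      using that
    proof (induction A rule: finite_induct)
      case (insert a A)
      then have "f a * t ^ a \<in> S_ideal 0" "(\<Sum>i\<in>A. f i * t ^ i) \<in> S_ideal 0"
        using ml[OF tp[of a]] by auto
      then show ?case using ad insert.hyps by simp
    qed (simp add: zr)
    then show ?thesis by (metis finite_atLeastAtMost Icc_subset_Ici_iff order_refl)
  qed
  have "S_relators n \<subseteq> S_ideal 0"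
    using s1 mi[OF mr[OF t] ml[OF sm[of "\<lambda>_. 1"]]] mi[OF mr[OF t] ml[OF sm]] tp[of "n + 1"]
    unfolding S_relators_def Let_def s_def[symmetric] sb_def[symmetric] t_def[symmetric] by simp
  then show ?thesis
    using ring.genideal_minimal[OF ring_free_ring ideal_S_ideal[of 0]]
    unfolding S_ideal_def[of n] by blast
qed

lemma is_S_proj0_ex: "\<exists>p. is_S_proj0 n p"
proof -
  interpret J: ideal "S_ideal 0" free_ring by (rule ideal_S_ideal)
  define p where "p = (\<lambda>X. S_ideal 0 <+>\<^bsub>free_ring\<^esub> X)"
  have z: "0 \<in> S_ideal n" "0 \<in> S_ideal 0"
    using additive_subgroup.zero_closed[OF ideal.axioms(1)[OF ideal_S_ideal]]
    by (simp_all add: free_ring_def)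
  have ad: "x + y \<in> S_ideal 0" if "x \<in> S_ideal 0" "y \<in> S_ideal 0" for x y
    using additive_subgroup.a_closed[OF ideal.axioms(1)[OF ideal_S_ideal[of 0]] that] by (simp add: free_ring_def)
  have p: "p (S_class n x) = S_class 0 x" for x
  proof -
    have cls: "S_class m x = {h + x | h. h \<in> S_ideal m}" for m
      by (auto simp: S_class_def a_r_coset_def r_coset_def free_ring_def)
    have "p (S_class n x) = {g + h + x | g h. g \<in> S_ideal 0 \<and> h \<in> S_ideal n}"
      unfolding cls p_def set_add_def set_mult_def by (auto simp: free_ring_def add.assoc)
    also have "\<dots> = S_class 0 x"
    proof
      show "{g + h + x | g h. g \<in> S_ideal 0 \<and> h \<in> S_ideal n} \<subseteq> S_class 0 x"
        unfolding cls using S_ideal_subset_0[of n] ad by blast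
      show "S_class 0 x \<subseteq> {g + h + x | g h. g \<in> S_ideal 0 \<and> h \<in> S_ideal n}"
        unfolding cls using z(1) by (clarsimp, metis add.right_neutral)
    qed
    finally show ?thesis .
  qed
  have car: "\<exists>x. X = S_class n x" if "X \<in> carrier (S_ring n)" for X
    using that by (auto simp: S_ring_def S_class_def FactRing_def A_RCOSETS_defs a_r_coset_def r_coset_def)
  have hom: "S_class m \<in> ring_hom free_ring (S_ring m)" for m
    unfolding S_class_def S_ring_def using ideal.rcos_ring_hom[OF ideal_S_ideal[of m]] by simp
  note [simp] = ring_hom_mult[OF hom, symmetric] ring_hom_add[OF hom, symmetric]
    ring_hom_one[OF hom, symmetric]
  have c: "carrier free_ring = UNIV" by (simp add: free_ring_def)
  have "p \<in> ring_hom (S_ring n) (S_ring 0)"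
  proof (rule ring_hom_memI)
    fix X assume "X \<in> carrier (S_ring n)"
    then obtain x where X: "X = S_class n x" using car by blast
    show "p X \<in> carrier (S_ring 0)"
      using ring_hom_closed[OF hom[of 0], of x] by (simp add: X p c)
    fix Y assume "Y \<in> carrier (S_ring n)"
    then obtain y where Y: "Y = S_class n y" using car by blast
    show "p (X \<otimes>\<^bsub>S_ring n\<^esub> Y) = p X \<otimes>\<^bsub>S_ring 0\<^esub> p Y"
      "p (X \<oplus>\<^bsub>S_ring n\<^esub> Y) = p X \<oplus>\<^bsub>S_ring 0\<^esub> p Y"
      by (simp_all add: X Y p c)
  qed (simp add: p)
  moreover have "S_class 0 (gen Gen_t) = \<zero>\<^bsub>S_ring 0\<^esub>"
  proof -
    have "S_relators 0 \<subseteq> S_ideal 0"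
      unfolding S_ideal_def by (rule ring.genideal_self[OF ring_free_ring]) (simp add: free_ring_def)
    then have "gen Gen_t \<in> S_ideal 0" by (simp add: S_relators_def Let_def)
    then show ?thesis
      by (simp add: S_class_def S_ring_def FactRing_def J.a_rcos_const)
  qed
  ultimately show ?thesis
    unfolding is_S_proj0_def by (intro exI[of _ p]) (simp add: s_elt_def t_elt_def p)
qed

lemma is_S_proj0: "is_S_proj0 n (S_proj0 n)"
  unfolding S_proj0_def by (rule someI_ex[OF is_S_proj0_ex])


section \<open>Quasideterminants\<close>

text \<open>
  Matrices are functions on indices. \<open>A\<^sup>i\<^sup>j\<close> keeps the original row and column indices, so its rows are
  indexed by \<open>{1..m} - {i}\<close> and its columns by \<open>{1..m} - {j}\<close>; an inverse has rows indexed by the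
  columns of the matrix and vice versa.
\<close>

definition is_mat_inverse ::
  "('a, 'b) ring_scheme \<Rightarrow> 'i set \<Rightarrow> 'j set \<Rightarrow> ('i \<Rightarrow> 'j \<Rightarrow> 'a) \<Rightarrow> ('j \<Rightarrow> 'i \<Rightarrow> 'a) \<Rightarrow> bool" where
  "is_mat_inverse R I J A B \<longleftrightarrow>
    (\<forall>q\<in>J. \<forall>p\<in>I. B q p \<in> carrier R) \<and>
    (\<forall>p\<in>I. \<forall>p'\<in>I. (\<Oplus>\<^bsub>R\<^esub>q\<in>J. A p q \<otimes>\<^bsub>R\<^esub> B q p') = (if p = p' then \<one>\<^bsub>R\<^esub> else \<zero>\<^bsub>R\<^esub>)) \<and>
    (\<forall>q\<in>J. \<forall>q'\<in>J. (\<Oplus>\<^bsub>R\<^esub>p\<in>I. B q p \<otimes>\<^bsub>R\<^esub> A p q') = (if q = q' then \<one>\<^bsub>R\<^esub> else \<zero>\<^bsub>R\<^esub>))"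

definition mat_inverse ::
  "('a, 'b) ring_scheme \<Rightarrow> 'i set \<Rightarrow> 'j set \<Rightarrow> ('i \<Rightarrow> 'j \<Rightarrow> 'a) \<Rightarrow> ('j \<Rightarrow> 'i \<Rightarrow> 'a)" where
  "mat_inverse R I J A = (SOME B. is_mat_inverse R I J A B)"

definition quasidet_defined ::
  "('a, 'b) ring_scheme \<Rightarrow> nat \<Rightarrow> (nat \<Rightarrow> nat \<Rightarrow> 'a) \<Rightarrow> nat \<Rightarrow> nat \<Rightarrow> bool" where
  "quasidet_defined R m A i j \<longleftrightarrow>
    m = 1 \<or> m > 1 \<and> (\<exists>B. is_mat_inverse R ({1..m} - {i}) ({1..m} - {j}) A B)"

definition quasidet ::
  "('a, 'b) ring_scheme \<Rightarrow> nat \<Rightarrow> (nat \<Rightarrow> nat \<Rightarrow> 'a) \<Rightarrow> nat \<Rightarrow> nat \<Rightarrow> 'a" where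
  "quasidet R m A i j =
    (if m = 1 then A i j
     else let I = {1..m} - {i}; J = {1..m} - {j}; B = mat_inverse R I J A in
       A i j \<ominus>\<^bsub>R\<^esub> (\<Oplus>\<^bsub>R\<^esub>q\<in>J. \<Oplus>\<^bsub>R\<^esub>p\<in>I. A i q \<otimes>\<^bsub>R\<^esub> B q p \<otimes>\<^bsub>R\<^esub> A p j))"


section \<open>Flat virtual knot diagrams\<close>

text \<open>
  The oriented circle is \<open>\<real>/\<int>\<close> with increasing parameter; a map from it is a 1-periodic function
  on the reals, and \<open>{0..<1}\<close> represents its points.
\<close>

type_synonym plane = "real^2"

definition velocity :: "(real \<Rightarrow> plane) \<Rightarrow> real \<Rightarrow> plane" where
  "velocity c x = vector_derivative c (at x)"

definition smooth_curve :: "(real \<Rightarrow> plane) \<Rightarrow> bool" where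
  "smooth_curve c \<longleftrightarrow> (\<forall>m x. (velocity ^^ m) c differentiable at x)"

definition circle_immersion :: "(real \<Rightarrow> plane) \<Rightarrow> bool" where
  "circle_immersion c \<longleftrightarrow>
    (\<forall>x. c (x + 1) = c x) \<and> smooth_curve c \<and> (\<forall>x. velocity c x \<noteq> 0)"

definition preimages :: "(real \<Rightarrow> plane) \<Rightarrow> plane set \<Rightarrow> real set" where
  "preimages c P = {x \<in> {0..<1}. c x \<in> P}"

definition multiple_points :: "(real \<Rightarrow> plane) \<Rightarrow> plane set" where
  "multiple_points c = {p. \<exists>x\<in>preimages c {p}. \<exists>y\<in>preimages c {p}. x \<noteq> y}"

definition orient :: "plane \<Rightarrow> plane \<Rightarrow> real" where
  "orient u v = det (vector [u, v] :: real^2^2)"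

definition generic_immersion :: "(real \<Rightarrow> plane) \<Rightarrow> bool" where
  "generic_immersion c \<longleftrightarrow>
    circle_immersion c \<and>
    finite (multiple_points c) \<and>
    (\<forall>p\<in>multiple_points c.
      card (preimages c {p}) = 2 \<and>
      (\<forall>x\<in>preimages c {p}. \<forall>y\<in>preimages c {p}.
        x \<noteq> y \<longrightarrow> orient (velocity c x) (velocity c y) \<noteq> 0))"

text \<open>The double points that are not flat are the virtual crossings.\<close>

record diagram =
  curve :: "real \<Rightarrow> plane"
  flat_crossings :: "plane set"

definition flat_virtual_knot_diagram :: "diagram \<Rightarrow> bool" where
  "flat_virtual_knot_diagram D \<longleftrightarrow>
    generic_immersion (curve D) \<and> flat_crossings D \<subseteq> multiple_points (curve D)"

definition is_fake_vertex_set :: "diagram \<Rightarrow> plane set \<Rightarrow> bool" where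
  "is_fake_vertex_set D F \<longleftrightarrow>
    finite F \<and> F \<subseteq> range (curve D) - multiple_points (curve D)"


section \<open>Arcs and coloring matrices\<close>

text \<open>
  Each arc is recorded by the parameter of its initial point. Arcs are labeled \<open>1, \<dots>, k\<close> along the
  orientation; \<open>r\<close> selects the starting arc (rotating the list of initial parameters by \<open>r\<close>), and
  \<open>r\<close> in \<open>{0..<k}\<close> gives each choice exactly once. Arc \<open>i\<close> ends where the next arc starts.
\<close>

definition vertices :: "diagram \<Rightarrow> plane set \<Rightarrow> plane set" where
  "vertices D F = flat_crossings D \<union> F"

definition num_arcs :: "diagram \<Rightarrow> plane set \<Rightarrow> nat" where
  "num_arcs D F = card (preimages (curve D) (vertices D F))"

definition arc_start :: "diagram \<Rightarrow> plane set \<Rightarrow> nat \<Rightarrow> nat \<Rightarrow> real" where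
  "arc_start D F r i =
    rotate r (sorted_list_of_set (preimages (curve D) (vertices D F))) ! (i - 1)"

definition prev_arc :: "diagram \<Rightarrow> plane set \<Rightarrow> nat \<Rightarrow> nat" where
  "prev_arc D F i = (if i = 1 then num_arcs D F else i - 1)"

text \<open>For arc \<open>i\<close> starting at a flat crossing: the arc leaving that crossing along the other strand.\<close>

definition opposite_arc :: "diagram \<Rightarrow> plane set \<Rightarrow> nat \<Rightarrow> nat \<Rightarrow> nat" where
  "opposite_arc D F r i =
    (THE i'. i' \<in> {1..num_arcs D F} \<and> i' \<noteq> i \<and>
      curve D (arc_start D F r i') = curve D (arc_start D F r i))"

text \<open>
  At a flat crossing, strand 1 and strand 2 are named so that their velocities, in this order, form
  a positively oriented basis.
\<close>

definition on_strand2 :: "diagram \<Rightarrow> plane set \<Rightarrow> nat \<Rightarrow> nat \<Rightarrow> bool" where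
  "on_strand2 D F r i \<longleftrightarrow>
    orient (velocity (curve D) (arc_start D F r (opposite_arc D F r i)))
      (velocity (curve D) (arc_start D F r i)) > 0"

definition coloring_matrix ::
  "nat \<Rightarrow> diagram \<Rightarrow> plane set \<Rightarrow> nat \<Rightarrow> nat \<Rightarrow> nat \<Rightarrow> free_alg set" where
  "coloring_matrix n D F r i l =
    (let R = S_ring n; s = s_elt n; s' = sinv_elt n; t = t_elt n;
         e = (\<lambda>m. if l = m then \<one>\<^bsub>R\<^esub> else \<zero>\<^bsub>R\<^esub>);
         h = prev_arc D F i;
         j = prev_arc D F (opposite_arc D F r i)
     in if curve D (arc_start D F r i) \<in> flat_crossings D then
          (if on_strand2 D F r i
           then e i \<ominus>\<^bsub>R\<^esub> s \<otimes>\<^bsub>R\<^esub> e h \<ominus>\<^bsub>R\<^esub> t \<otimes>\<^bsub>R\<^esub> e j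
           else e i \<ominus>\<^bsub>R\<^esub> s' \<otimes>\<^bsub>R\<^esub> (\<one>\<^bsub>R\<^esub> \<ominus>\<^bsub>R\<^esub> t [^]\<^bsub>R\<^esub> (2::nat)) \<otimes>\<^bsub>R\<^esub> e h
                  \<oplus>\<^bsub>R\<^esub> s' \<otimes>\<^bsub>R\<^esub> t \<otimes>\<^bsub>R\<^esub> s \<otimes>\<^bsub>R\<^esub> e j)
        else e i \<ominus>\<^bsub>R\<^esub> e h)"

end

theory Submission
  imports Defs
begin

text \<open>
  The quasideterminant is read as the value of a null vector. If the minor obtained by deleting row
  and column \<open>b\<close> of \<open>A\<close> is invertible, there is a column \<open>x\<close> with \<open>x\<^sub>b = 1\<close> for which \<open>A x\<close>
  vanishes outside row \<open>b\<close>, and the entry of \<open>A x\<close> in row \<open>b\<close> is \<open>|A|\<^sub>b\<^sub>b\<close> (\<open>right_null_vector\<close>).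

  In this form the effect of fake vertices disappears. Index each arc by the parameter of its initial
  point. The coefficients of a row then depend only on that point, and the vertex set enters only
  through the cyclic predecessor of a point. If the vertex set is enlarged by fake vertices, the
  vector that repeats the entry of an arc on all the pieces into which the arc is cut is again a null
  vector, with the same value: at an old vertex the row equation is unchanged, and at a new one it
  says that two pieces of one arc have equal entries (\<open>quasidet_null_vector\<close>). The labels of the
  arcs have disappeared as well. So both quasideterminants \<open>q\<close> and \<open>q'\<close> are values of null vectors
  \<open>x\<close> and \<open>x'\<close>, at two points \<open>b\<close> and \<open>b'\<close>, of one matrix \<open>M\<close>, that of the union of the two
  vertex sets. Let \<open>y\<close> be a row with \<open>y\<^sub>b = 1\<close> for which \<open>y M\<close> vanishes outside column \<open>b\<close>.
  Pairing \<open>y\<close> with \<open>x\<close> shows that the entry of \<open>y M\<close> in column \<open>b\<close> is \<open>q\<close>, and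
  pairing it with \<open>x'\<close> then gives \<open>q x'\<^sub>b = y\<^sub>b\<^sub>' q'\<close> (\<open>null_vector_values_equivalent\<close>).

  It remains to see that \<open>x'\<^sub>b\<close> and \<open>y\<^sub>b\<^sub>'\<close> are units that agree modulo \<open>t\<close>. The relations
  give \<open>t R \<subseteq> R t\<close>, so the left ideal \<open>R t\<close> is two-sided and nilpotent, and everything
  can be tested modulo \<open>t\<close>. There the row of \<open>p\<close> says that the entry at \<open>p\<close> is \<open>s\<close>, its inverse
  or \<open>1\<close> times the entry at the predecessor of \<open>p\<close>. The two strands at a crossing have opposite
  exponents, so the exponents sum to zero around the circle and there is a height function \<open>h\<close>
  for which \<open>s\<close> to the power \<open>h\<close> solves all the equations, the one at the base point included.
  Both \<open>x'\<^sub>b\<close> and \<open>y\<^sub>b\<^sub>'\<close> are therefore congruent to \<open>s\<close> to the power \<open>h(b) - h(b')\<close>. The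
  minors are invertible because they are unitriangular modulo \<open>t\<close>, in the order in which the arcs
  follow the deleted one.
\<close>

section \<open>Finite sums in a noncommutative ring\<close>

context ring
begin

lemma minus_zero_imp_eq:
  assumes "a \<ominus> b = \<zero>" "a \<in> carrier R" "b \<in> carrier R"
  shows "a = b"
  using assms minus_equality[of a "\<ominus> b"] by (simp add: minus_eq)

lemma finsum_remove:
  assumes "finite S" "b \<in> S" "f \<in> S \<rightarrow> carrier R"
  shows "(\<Oplus>q\<in>S. f q) = f b \<oplus> (\<Oplus>q\<in>S - {b}. f q)"
  using assms finsum_insert[of "S - {b}" b f] by (auto simp: insert_absorb Pi_def)

lemma add_diff_cancel_left:
  assumes "z \<in> carrier R" "x \<in> carrier R" "y \<in> carrier R"
  shows "(z \<oplus> x) \<ominus> (z \<oplus> y) = x \<ominus> y"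
  using assms by algebra

lemma finsum_diff:
  assumes "f \<in> I \<rightarrow> carrier R" "g \<in> I \<rightarrow> carrier R"
  shows "(\<Oplus>q\<in>I. f q \<ominus> g q) = (\<Oplus>q\<in>I. f q) \<ominus> (\<Oplus>q\<in>I. g q)"
proof (cases "finite I")
  case True
  then show ?thesis using assms
  proof (induction I rule: finite_induct)
    case (insert a I)
    have c: "f a \<in> carrier R" "g a \<in> carrier R" "f \<in> I \<rightarrow> carrier R" "g \<in> I \<rightarrow> carrier R"
      using insert.prems by auto
    have c2: "(\<Oplus>q\<in>I. f q) \<in> carrier R" "(\<Oplus>q\<in>I. g q) \<in> carrier R"
      using c by auto
    have "(\<lambda>q. f q \<ominus> g q) \<in> I \<rightarrow> carrier R" using c by auto
    then have "(\<Oplus>q\<in>insert a I. f q \<ominus> g q) = (f a \<ominus> g a) \<oplus> ((\<Oplus>q\<in>I. f q) \<ominus> (\<Oplus>q\<in>I. g q))"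
      using insert c by simp
    also have "\<dots> = (f a \<oplus> (\<Oplus>q\<in>I. f q)) \<ominus> (g a \<oplus> (\<Oplus>q\<in>I. g q))"
      using c(1,2) c2 by algebra
    finally show ?case using insert c by simp
  qed (simp add: minus_eq)
qed (simp add: minus_eq)

lemma finsum_swap:
  assumes "finite I" "finite J" "\<And>p q. p \<in> I \<Longrightarrow> q \<in> J \<Longrightarrow> f p q \<in> carrier R"
  shows "(\<Oplus>p\<in>I. \<Oplus>q\<in>J. f p q) = (\<Oplus>q\<in>J. \<Oplus>p\<in>I. f p q)"
  using assms(1,3)
proof (induction I rule: finite_induct)
  case (insert a I)
  have c: "f a \<in> J \<rightarrow> carrier R" "(\<lambda>q. \<Oplus>p\<in>I. f p q) \<in> J \<rightarrow> carrier R"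
    "(\<lambda>p. \<Oplus>q\<in>J. f p q) \<in> I \<rightarrow> carrier R"
    using insert.prems by (auto intro!: finsum_closed)
  have "(\<Oplus>p\<in>insert a I. \<Oplus>q\<in>J. f p q) = (\<Oplus>q\<in>J. f a q) \<oplus> (\<Oplus>q\<in>J. \<Oplus>p\<in>I. f p q)"
    using insert c by simp
  also have "\<dots> = (\<Oplus>q\<in>J. f a q \<oplus> (\<Oplus>p\<in>I. f p q))"
    using c by (simp add: finsum_addf)
  also have "\<dots> = (\<Oplus>q\<in>J. \<Oplus>p\<in>insert a I. f p q)"
    using insert c by (intro finsum_cong') (auto simp: Pi_def)
  finally show ?case .
qed simp

lemma finsum_assoc:
  assumes "finite I" "finite J"
    and "\<And>p. p \<in> I \<Longrightarrow> y p \<in> carrier R" "\<And>q. q \<in> J \<Longrightarrow> x q \<in> carrier R"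
    and "\<And>p q. p \<in> I \<Longrightarrow> q \<in> J \<Longrightarrow> A p q \<in> carrier R"
  shows "(\<Oplus>p\<in>I. y p \<otimes> (\<Oplus>q\<in>J. A p q \<otimes> x q)) = (\<Oplus>q\<in>J. (\<Oplus>p\<in>I. y p \<otimes> A p q) \<otimes> x q)"
proof -
  have "(\<Oplus>p\<in>I. y p \<otimes> (\<Oplus>q\<in>J. A p q \<otimes> x q)) = (\<Oplus>p\<in>I. \<Oplus>q\<in>J. y p \<otimes> A p q \<otimes> x q)"
    using assms by (intro finsum_cong') (auto simp: finsum_rdistr m_assoc intro!: finsum_closed finsum_cong')
  also have "\<dots> = (\<Oplus>q\<in>J. \<Oplus>p\<in>I. y p \<otimes> A p q \<otimes> x q)"
    using assms by (intro finsum_swap) auto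
  also have "\<dots> = (\<Oplus>q\<in>J. (\<Oplus>p\<in>I. y p \<otimes> A p q) \<otimes> x q)"
    using assms by (intro finsum_cong') (auto simp: finsum_ldistr Pi_def intro!: finsum_closed)
  finally show ?thesis .
qed

lemma finsum_unit_left:
  assumes "finite I" "p \<in> I" "f \<in> I \<rightarrow> carrier R"
  shows "(\<Oplus>q\<in>I. (if q = p then \<one> else \<zero>) \<otimes> f q) = f p"
proof -
  have "(\<Oplus>q\<in>I. (if q = p then \<one> else \<zero>) \<otimes> f q) = (\<Oplus>q\<in>I. if p = q then f q else \<zero>)"
    using assms by (intro finsum_cong') (auto simp: Pi_def)
  then show ?thesis using assms finsum_singleton[of p I f] by simp
qed

lemma finsum_unit_right:
  assumes "finite I" "p \<in> I" "f \<in> I \<rightarrow> carrier R"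
  shows "(\<Oplus>q\<in>I. f q \<otimes> (if q = p then \<one> else \<zero>)) = f p"
proof -
  have "(\<Oplus>q\<in>I. f q \<otimes> (if q = p then \<one> else \<zero>)) = (\<Oplus>q\<in>I. if p = q then f q else \<zero>)"
    using assms by (intro finsum_cong') (auto simp: Pi_def)
  then show ?thesis using assms finsum_singleton[of p I f] by simp
qed

end

section \<open>The powers of a normal nilpotent element\<close>

text \<open>
  The inclusion \<open>t R \<subseteq> R t\<close> makes each \<open>R t\<^sup>m\<close> a two-sided ideal. It is the form in which the
  commutation rules of \<open>t\<close> with \<open>s\<close> and its inverse will provide normality.
\<close>

locale normal_nilpotent = ring R for R (structure) +
  fixes t and N :: nat
  assumes t_closed [simp]: "t \<in> carrier R"
    and normal: "r \<in> carrier R \<Longrightarrow> \<exists>r'\<in>carrier R. t \<otimes> r = r' \<otimes> t"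
    and nilpotent: "t [^] N = \<zero>"
begin

definition T :: "nat \<Rightarrow> 'a set" where
  "T m = {r \<otimes> t [^] m | r. r \<in> carrier R}"

lemma T_closed: "x \<in> T m \<Longrightarrow> x \<in> carrier R"
  by (auto simp: T_def)

lemma T_0: "T 0 = carrier R"
  by (auto simp: T_def) (metis r_one)

lemma T_nilpotent: "x \<in> T N \<Longrightarrow> x = \<zero>"
  by (auto simp: T_def nilpotent)

lemma T_zero [simp]: "\<zero> \<in> T m"
  by (auto simp: T_def intro!: exI[of _ \<zero>])

lemma T_add: "x \<in> T m \<Longrightarrow> y \<in> T m \<Longrightarrow> x \<oplus> y \<in> T m"
  by (auto simp: T_def) (metis a_closed l_distr nat_pow_closed t_closed)

lemma T_neg: "x \<in> T m \<Longrightarrow> \<ominus> x \<in> T m"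
  by (auto simp: T_def) (metis a_inv_closed l_minus nat_pow_closed t_closed)

lemma T_minus: "x \<in> T m \<Longrightarrow> y \<in> T m \<Longrightarrow> x \<ominus> y \<in> T m"
  by (simp add: minus_eq T_add T_neg)

lemma power_normal: "r \<in> carrier R \<Longrightarrow> \<exists>r'\<in>carrier R. t [^] (m::nat) \<otimes> r = r' \<otimes> t [^] m"
proof (induction m arbitrary: r)
  case (Suc m)
  obtain r' where r': "r' \<in> carrier R" "t \<otimes> r = r' \<otimes> t" using normal[OF Suc.prems] by blast
  obtain r'' where r'': "r'' \<in> carrier R" "t [^] m \<otimes> r' = r'' \<otimes> t [^] m" using Suc.IH[OF r'(1)] by blast
  have "t [^] Suc m \<otimes> r = (t [^] m \<otimes> r') \<otimes> t" using r' Suc.prems by (simp add: m_assoc)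
  also have "\<dots> = r'' \<otimes> t [^] Suc m" using r'' by (simp add: m_assoc)
  finally show ?case using r'' by blast
qed auto

lemma T_mult:
  assumes "x \<in> T a" "y \<in> T b"
  shows "x \<otimes> y \<in> T (a + b)"
proof -
  obtain r r' where r: "r \<in> carrier R" "x = r \<otimes> t [^] a" and r': "r' \<in> carrier R" "y = r' \<otimes> t [^] b"
    using assms by (auto simp: T_def)
  obtain u where u: "u \<in> carrier R" "t [^] a \<otimes> r' = u \<otimes> t [^] a" using power_normal[OF r'(1)] by blast
  have "x \<otimes> y = r \<otimes> (t [^] a \<otimes> r') \<otimes> t [^] b" using r r' by (simp add: m_assoc)
  also have "\<dots> = (r \<otimes> u) \<otimes> t [^] (a + b)" using r u by (simp add: nat_pow_mult[symmetric] m_assoc)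
  finally show ?thesis using r u by (auto simp: T_def)
qed

lemma T_mult_left: "x \<in> carrier R \<Longrightarrow> y \<in> T m \<Longrightarrow> x \<otimes> y \<in> T m"
  using T_mult[of x 0 y m] by (simp add: T_0)

lemma T_mult_right: "x \<in> T m \<Longrightarrow> y \<in> carrier R \<Longrightarrow> x \<otimes> y \<in> T m"
  using T_mult[of x m y 0] by (simp add: T_0)

lemma T_finsum:
  assumes "\<And>q. q \<in> I \<Longrightarrow> f q \<in> T m"
  shows "(\<Oplus>q\<in>I. f q) \<in> T m"
proof (cases "finite I")
  case True
  then show ?thesis using assms
  proof (induction I rule: finite_induct)
    case (insert a I)
    then have "f \<in> I \<rightarrow> carrier R" "f a \<in> carrier R" using T_closed by blast+
    then show ?case using insert T_add by simp
  qed simp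
qed simp

end

section \<open>Matrices that are unitriangular modulo the ideal\<close>

context normal_nilpotent
begin

abbreviation delta :: "'i \<Rightarrow> 'i \<Rightarrow> 'a" where
  "delta p q \<equiv> (if p = q then \<one> else \<zero>)"

text \<open>
  Below the diagonal, that is where \<open>ord q < ord p\<close>, the entries are arbitrary. Distinct indices may
  have equal \<open>ord\<close>, in which case both entries between them lie in the ideal.
\<close>

definition unitriangular :: "('i \<Rightarrow> nat) \<Rightarrow> 'i set \<Rightarrow> ('i \<Rightarrow> 'i \<Rightarrow> 'a) \<Rightarrow> bool" where
  "unitriangular ord I A \<longleftrightarrow>
    (\<forall>p\<in>I. \<forall>q\<in>I. A p q \<in> carrier R \<and> (ord p \<le> ord q \<longrightarrow> A p q \<ominus> delta p q \<in> T 1))"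

text \<open>
  Write \<open>A = 1 - K\<close> and iterate \<open>x \<mapsto> v + K x\<close> from zero. The difference of consecutive iterates
  is a power of \<open>K\<close> applied to \<open>v\<close>, a sum over paths in the index set. A step of a path that does
  not lower \<open>ord\<close> contributes a factor from the ideal, and fewer than \<open>k\<close> steps in a row can lower
  it, where \<open>k\<close> bounds \<open>ord\<close>. So long paths lie in a high power of the nilpotent ideal, and the
  iteration becomes stationary.
\<close>

lemma unitriangular_solution:
  assumes fin: "finite I" and A: "unitriangular ord I A" and v: "\<And>p. p \<in> I \<Longrightarrow> v p \<in> carrier R"
  shows "\<exists>x. (\<forall>p\<in>I. x p \<in> carrier R) \<and> (\<forall>p\<in>I. (\<Oplus>q\<in>I. A p q \<otimes> x q) = v p)"
proof -
  have Ac [simp]: "A p q \<in> carrier R" if "p \<in> I" "q \<in> I" for p q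
    using A that by (auto simp: unitriangular_def)
  define K where "K p q = delta p q \<ominus> A p q" for p q
  have Kc [simp]: "K p q \<in> carrier R" if "p \<in> I" "q \<in> I" for p q
    using that by (simp add: K_def)
  have K1: "K p q \<in> T 1" if "p \<in> I" "q \<in> I" "ord p \<le> ord q" for p q
  proof -
    have "K p q = \<ominus> (A p q \<ominus> delta p q)"
      using that unfolding K_def by (simp add: minus_eq minus_add a_comm)
    then show ?thesis using A that T_neg by (auto simp: unitriangular_def)
  qed
  obtain k where k: "ord p < k" if "p \<in> I" for p
    using finite_imageI[OF fin, of ord] by (metis finite_nat_set_iff_bounded imageI)
  define X where "X = rec_nat (\<lambda>_. \<zero>) (\<lambda>_ x p. v p \<oplus> (\<Oplus>q\<in>I. K p q \<otimes> x q))"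
  have X0: "X 0 p = \<zero>" and XS: "X (Suc m) p = v p \<oplus> (\<Oplus>q\<in>I. K p q \<otimes> X m q)" for m p
    by (simp_all add: X_def)
  have Xc [simp]: "X m p \<in> carrier R" if "p \<in> I" for m p
    using that by (induction m arbitrary: p) (auto simp: X0 XS v intro!: finsum_closed)
  \<comment> \<open>The inequality forces a path of \<open>m\<close> steps from \<open>p\<close> to have \<open>c\<close> steps that do not lower \<open>ord\<close>.\<close>
  have diff: "X (Suc m) p \<ominus> X m p \<in> T c" if "p \<in> I" "c * k + ord p < m + k" for m p c
    using that
  proof (induction m arbitrary: p c)
    case 0
    then have "c = 0" by (cases c) auto
    then show ?case using 0 by (simp add: T_0)
  next
    case (Suc m)
    have s: "(\<Oplus>q\<in>I. K p q \<otimes> X m q) \<in> carrier R" "(\<Oplus>q\<in>I. K p q \<otimes> X (Suc m) q) \<in> carrier R" for m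
      using Suc.prems by (auto intro!: finsum_closed)
    have "X (Suc (Suc m)) p \<ominus> X (Suc m) p
        = (\<Oplus>q\<in>I. K p q \<otimes> X (Suc m) q) \<ominus> (\<Oplus>q\<in>I. K p q \<otimes> X m q)"
      unfolding XS[of "Suc m"] XS[of m p] using s v[OF Suc.prems(1)] by (intro add_diff_cancel_left)
    also have "\<dots> = (\<Oplus>q\<in>I. K p q \<otimes> X (Suc m) q \<ominus> K p q \<otimes> X m q)"
      using Suc.prems by (subst finsum_diff) auto
    also have "\<dots> = (\<Oplus>q\<in>I. K p q \<otimes> (X (Suc m) q \<ominus> X m q))"
      using Suc.prems by (intro finsum_cong') (auto simp: minus_eq r_distr r_minus)
    also have "\<dots> \<in> T c"
    proof (rule T_finsum)
      fix q assume q: "q \<in> I"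
      show "K p q \<otimes> (X (Suc m) q \<ominus> X m q) \<in> T c"
      proof (cases "ord p \<le> ord q")
        case False
        then have "X (Suc m) q \<ominus> X m q \<in> T c" using Suc.IH[OF q, of c] Suc.prems by simp
        then show ?thesis using Suc.prems q T_mult_left by simp
      next
        case True
        show ?thesis
        proof (cases c)
          case 0
          then show ?thesis using Suc.prems q by (simp add: T_0)
        next
          case (Suc c')
          then have "X (Suc m) q \<ominus> X m q \<in> T c'"
            using Suc.IH[OF q, of c'] Suc.prems k[OF q] by simp
          then show ?thesis using T_mult[OF K1[OF Suc.prems(1) q True]] Suc by simp
        qed
      qed
    qed
    finally show ?case .
  qed
  define x where "x = X (N * k)"
  have xc: "x p \<in> carrier R" if "p \<in> I" for p using that by (simp add: x_def)
  have fix_x: "v p \<oplus> (\<Oplus>q\<in>I. K p q \<otimes> x q) = x p" if "p \<in> I" for p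
  proof -
    have "X (Suc (N * k)) p \<ominus> X (N * k) p \<in> T N" using that k by (intro diff) auto
    then have "X (Suc (N * k)) p \<ominus> X (N * k) p = \<zero>" by (rule T_nilpotent)
    from minus_zero_imp_eq[OF this Xc[OF that] Xc[OF that]] show ?thesis
      unfolding XS x_def .
  qed
  have "(\<Oplus>q\<in>I. A p q \<otimes> x q) = v p" if p: "p \<in> I" for p
  proof -
    have s: "(\<Oplus>q\<in>I. K p q \<otimes> x q) \<in> carrier R" using p xc by (auto intro!: finsum_closed)
    have "(\<Oplus>q\<in>I. A p q \<otimes> x q) = (\<Oplus>q\<in>I. delta q p \<otimes> x q \<ominus> K p q \<otimes> x q)"
    proof (rule finsum_cong')
      fix q assume q: "q \<in> I"
      show "A p q \<otimes> x q = delta q p \<otimes> x q \<ominus> K p q \<otimes> x q"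
        using Ac[OF p q] xc[OF q] unfolding K_def by (cases "p = q"; simp; algebra)
    qed (use p xc in auto)
    also have "\<dots> = (\<Oplus>q\<in>I. delta q p \<otimes> x q) \<ominus> (\<Oplus>q\<in>I. K p q \<otimes> x q)"
      using p xc by (intro finsum_diff) auto
    also have "(\<Oplus>q\<in>I. delta q p \<otimes> x q) = x p"
      using fin p xc by (intro finsum_unit_left) auto
    also have "x p \<ominus> (\<Oplus>q\<in>I. K p q \<otimes> x q) = v p"
      using fix_x[OF p, symmetric] v[OF p] s by (simp add: minus_eq a_assoc r_neg)
    finally show ?thesis .
  qed
  then show ?thesis using xc by blast
qed

text \<open>
  The inverse is again unitriangular modulo the ideal. This is what makes it two-sided below: it has
  a right inverse itself, which must then be the original matrix.
\<close>

lemma unitriangular_right_inverse: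
  assumes fin: "finite I" and A: "unitriangular ord I A"
  shows "\<exists>B. unitriangular ord I B \<and>
    (\<forall>p\<in>I. \<forall>p'\<in>I. (\<Oplus>q\<in>I. A p q \<otimes> B q p') = delta p p')"
proof -
  have Ac [simp]: "A p q \<in> carrier R" if "p \<in> I" "q \<in> I" for p q
    using A that by (auto simp: unitriangular_def)
  have "\<forall>p'. \<exists>x. (\<forall>p\<in>I. x p \<in> carrier R) \<and> (\<forall>p\<in>I. (\<Oplus>q\<in>I. A p q \<otimes> x q) = delta p p')"
    by (intro allI unitriangular_solution[OF fin A]) auto
  then obtain x where xc: "\<And>p p'. p \<in> I \<Longrightarrow> x p' p \<in> carrier R"
    and x: "\<And>p p'. p \<in> I \<Longrightarrow> (\<Oplus>q\<in>I. A p q \<otimes> x p' q) = delta p p'"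
    by metis
  have rearrange: "y \<ominus> (a \<otimes> y \<oplus> z) = \<ominus> ((a \<ominus> \<one>) \<otimes> y) \<ominus> z"
    if "a \<in> carrier R" "y \<in> carrier R" "z \<in> carrier R" for a y z
    using that by algebra
  have tri: "x p' p \<ominus> delta p p' \<in> T 1" if "p \<in> I" "p' \<in> I" "ord p \<le> ord p'" for p p'
    using that(1,3)
  proof (induction "ord p" arbitrary: p rule: less_induct)
    case less
    have off: "A p q \<otimes> x p' q \<in> T 1" if q: "q \<in> I - {p}" for q
    proof (cases "ord p \<le> ord q")
      case True
      then have "A p q \<ominus> delta p q \<in> T 1" using A less.prems q by (auto simp: unitriangular_def)
      then have "A p q \<in> T 1" using q less.prems by (simp add: minus_eq split: if_splits)
      then show ?thesis using xc q T_mult_right by blast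
    next
      case False
      then have "x p' q \<ominus> delta q p' \<in> T 1" using less q by auto
      moreover have "q \<noteq> p'" using False less.prems by auto
      ultimately have "x p' q \<in> T 1" using q xc by (simp add: minus_eq)
      then show ?thesis using q less.prems T_mult_left by simp
    qed
    let ?S = "\<Oplus>q\<in>I - {p}. A p q \<otimes> x p' q"
    have S: "?S \<in> T 1" using off by (rule T_finsum)
    have App: "A p p \<ominus> \<one> \<in> T 1" using A less.prems by (auto simp: unitriangular_def dest!: bspec)
    have row: "A p p \<otimes> x p' p \<oplus> ?S = delta p p'"
      using x[OF less.prems(1), of p'] fin less.prems(1) xc
      by (subst (asm) finsum_remove[of I p]) auto
    have "x p' p \<ominus> delta p p' = \<ominus> ((A p p \<ominus> \<one>) \<otimes> x p' p) \<ominus> ?S"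
      unfolding row[symmetric] using S xc less.prems T_closed by (intro rearrange) auto
    also have "\<dots> \<in> T 1"
      by (rule T_minus[OF T_neg[OF T_mult_right[OF App xc[OF less.prems(1)]]] S])
    finally show ?case .
  qed
  show ?thesis
    using xc x tri by (intro exI[of _ "\<lambda>q p'. x p' q"]) (auto simp: unitriangular_def)
qed

lemma unitriangular_invertible:
  assumes fin: "finite I" and A: "unitriangular ord I A"
  shows "\<exists>B. is_mat_inverse R I I A B"
proof -
  obtain B where B: "unitriangular ord I B"
    and AB: "\<And>p p'. p \<in> I \<Longrightarrow> p' \<in> I \<Longrightarrow> (\<Oplus>q\<in>I. A p q \<otimes> B q p') = delta p p'"
    using unitriangular_right_inverse[OF fin A] by blast
  obtain C where C: "unitriangular ord I C"
    and BC: "\<And>p p'. p \<in> I \<Longrightarrow> p' \<in> I \<Longrightarrow> (\<Oplus>q\<in>I. B p q \<otimes> C q p') = delta p p'"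
    using unitriangular_right_inverse[OF fin B] by blast
  have c: "A p q \<in> carrier R" "B p q \<in> carrier R" "C p q \<in> carrier R" if "p \<in> I" "q \<in> I" for p q
    using A B C that by (auto simp: unitriangular_def)
  have AC: "A p p' = C p p'" if p: "p \<in> I" "p' \<in> I" for p p'
  proof -
    have "A p p' = (\<Oplus>q\<in>I. A p q \<otimes> delta q p')"
      using fin p c by (subst finsum_unit_right) auto
    also have "\<dots> = (\<Oplus>q\<in>I. A p q \<otimes> (\<Oplus>m\<in>I. B q m \<otimes> C m p'))"
      using p c BC by (intro finsum_cong') auto
    also have "\<dots> = (\<Oplus>m\<in>I. (\<Oplus>q\<in>I. A p q \<otimes> B q m) \<otimes> C m p')"
      using fin p c by (intro finsum_assoc) auto
    also have "\<dots> = (\<Oplus>m\<in>I. delta m p \<otimes> C m p')"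
      using p c AB by (intro finsum_cong') auto
    also have "\<dots> = C p p'"
      using fin p c by (subst finsum_unit_left) auto
    finally show ?thesis .
  qed
  have "(\<Oplus>p\<in>I. B q p \<otimes> A p q') = delta q q'" if "q \<in> I" "q' \<in> I" for q q'
    using BC[OF that] AC that c by (subst finsum_cong'[where g="\<lambda>p. B q p \<otimes> C p q'"]) auto
  then show ?thesis
    using AB c by (intro exI[of _ B]) (auto simp: is_mat_inverse_def)
qed

text \<open>
  The case of a matrix with one entry, after division by \<open>u\<close>.
\<close>

lemma unit_plus_T:
  assumes u: "u \<in> Units R" and z: "z \<in> carrier R" and zu: "z \<ominus> u \<in> T 1"
  shows "z \<in> Units R"
proof -
  let ?a = "inv u \<otimes> z"
  have uc: "u \<in> carrier R" using u by blast
  have "?a \<ominus> \<one> = inv u \<otimes> (z \<ominus> u)" using u uc z by (simp add: minus_eq r_distr r_minus)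
  then have "?a \<ominus> \<one> \<in> T 1" using zu u T_mult_left by simp
  then have "unitriangular (\<lambda>_. 0) {()} (\<lambda>_ _. ?a)" using u z by (auto simp: unitriangular_def)
  then obtain B where "is_mat_inverse R {()} {()} (\<lambda>_ _. ?a) B"
    using unitriangular_invertible by blast
  then have "B () () \<in> carrier R" "?a \<otimes> B () () = \<one>" "B () () \<otimes> ?a = \<one>"
    using u z by (auto simp: is_mat_inverse_def)
  then have "?a \<in> Units R" using u z by (auto simp: Units_def)
  then have "u \<otimes> ?a \<in> Units R" using u by blast
  then show ?thesis using u uc z by (simp add: m_assoc[symmetric])
qed

end

section \<open>Quasideterminants and null vectors\<close>

context ring
begin

text \<open>
  The invertible minor determines the entries of \<open>x\<close> outside \<open>b\<close> from \<open>x b = \<one>\<close>; substituting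
  them into the row of \<open>b\<close> produces the formula that defines the quasideterminant.
\<close>

lemma right_null_vector:
  assumes fin: "finite S" and b: "b \<in> S"
    and A: "\<And>p q. p \<in> S \<Longrightarrow> q \<in> S \<Longrightarrow> A p q \<in> carrier R"
    and B: "is_mat_inverse R (S - {b}) (S - {b}) A B"
  shows "\<exists>x. (\<forall>q\<in>S. x q \<in> carrier R) \<and> x b = \<one> \<and>
    (\<forall>p\<in>S - {b}. (\<Oplus>q\<in>S. A p q \<otimes> x q) = \<zero>) \<and>
    (\<Oplus>q\<in>S. A b q \<otimes> x q) =
      A b b \<ominus> (\<Oplus>q\<in>S - {b}. \<Oplus>p\<in>S - {b}. A b q \<otimes> B q p \<otimes> A p b)"
proof -
  let ?I = "S - {b}"
  have Bc: "B q p \<in> carrier R" if "p \<in> ?I" "q \<in> ?I" for p q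
    using B that by (auto simp: is_mat_inverse_def)
  have AB: "(\<Oplus>q\<in>?I. A p q \<otimes> B q p') = (if p = p' then \<one> else \<zero>)" if "p \<in> ?I" "p' \<in> ?I" for p p'
    using B that unfolding is_mat_inverse_def by blast
  define g where "g q = (\<Oplus>p\<in>?I. B q p \<otimes> A p b)" for q
  have gc: "g q \<in> carrier R" if "q \<in> ?I" for q
    using that Bc A b by (auto simp: g_def intro!: finsum_closed)
  define x where "x q = (if q = b then \<one> else \<ominus> g q)" for q
  have xc: "x q \<in> carrier R" if "q \<in> S" for q using that gc by (simp add: x_def)
  have expand: "(\<Oplus>q\<in>S. A p q \<otimes> x q) = A p b \<ominus> (\<Oplus>q\<in>?I. A p q \<otimes> g q)" if p: "p \<in> S" for p
  proof -
    have "(\<Oplus>q\<in>S. A p q \<otimes> x q) = A p b \<oplus> (\<Oplus>q\<in>?I. A p q \<otimes> x q)"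
      using fin b p xc A by (subst finsum_remove[of S b]) (auto simp: x_def)
    also have "(\<Oplus>q\<in>?I. A p q \<otimes> x q) = (\<Oplus>q\<in>?I. \<zero> \<ominus> A p q \<otimes> g q)"
      using p gc A by (intro finsum_cong') (auto simp: x_def minus_eq r_minus)
    also have "\<dots> = \<ominus> (\<Oplus>q\<in>?I. A p q \<otimes> g q)"
      using p gc A by (subst finsum_diff) (auto simp: minus_eq intro!: finsum_closed)
    finally show ?thesis by (simp add: minus_eq)
  qed
  have "(\<Oplus>q\<in>?I. A p q \<otimes> g q) = A p b" if p: "p \<in> ?I" for p
  proof -
    have "(\<Oplus>q\<in>?I. A p q \<otimes> g q) = (\<Oplus>p'\<in>?I. (\<Oplus>q\<in>?I. A p q \<otimes> B q p') \<otimes> A p' b)"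
      unfolding g_def using fin p A Bc b by (intro finsum_assoc) auto
    also have "\<dots> = (\<Oplus>p'\<in>?I. (if p' = p then \<one> else \<zero>) \<otimes> A p' b)"
      using p A b by (intro finsum_cong') (auto simp: AB)
    also have "\<dots> = A p b" using fin p A b by (intro finsum_unit_left) auto
    finally show ?thesis .
  qed
  then have null: "(\<Oplus>q\<in>S. A p q \<otimes> x q) = \<zero>" if "p \<in> ?I" for p
    using that A b by (auto simp: expand minus_eq r_neg)
  have "(\<Oplus>q\<in>?I. A b q \<otimes> g q) = (\<Oplus>q\<in>?I. \<Oplus>p\<in>?I. A b q \<otimes> B q p \<otimes> A p b)"
  proof (rule finsum_cong')
    fix q assume q: "q \<in> ?I"
    have "A b q \<otimes> g q = (\<Oplus>p\<in>?I. A b q \<otimes> (B q p \<otimes> A p b))"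
      unfolding g_def using fin b q A Bc by (intro finsum_rdistr) auto
    also have "\<dots> = (\<Oplus>p\<in>?I. A b q \<otimes> B q p \<otimes> A p b)"
      by (rule finsum_cong') (use b q A Bc m_assoc in auto)
    finally show "A b q \<otimes> g q = (\<Oplus>p\<in>?I. A b q \<otimes> B q p \<otimes> A p b)" .
  qed (use b A Bc in \<open>auto intro!: finsum_closed\<close>)
  then show ?thesis
    using xc null expand[OF b] by (intro exI[of _ x]) (auto simp: x_def)
qed

lemma left_null_vector:
  assumes fin: "finite S" and b: "b \<in> S"
    and A: "\<And>p q. p \<in> S \<Longrightarrow> q \<in> S \<Longrightarrow> A p q \<in> carrier R"
    and B: "is_mat_inverse R (S - {b}) (S - {b}) A B"
  shows "\<exists>y. (\<forall>p\<in>S. y p \<in> carrier R) \<and> y b = \<one> \<and>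
    (\<forall>q\<in>S - {b}. (\<Oplus>p\<in>S. y p \<otimes> A p q) = \<zero>)"
proof -
  let ?I = "S - {b}"
  have Bc: "B q p \<in> carrier R" if "p \<in> ?I" "q \<in> ?I" for p q
    using B that by (auto simp: is_mat_inverse_def)
  have BA: "(\<Oplus>p\<in>?I. B q p \<otimes> A p q') = (if q = q' then \<one> else \<zero>)" if "q \<in> ?I" "q' \<in> ?I" for q q'
    using B that unfolding is_mat_inverse_def by blast
  define g where "g p = (\<Oplus>q\<in>?I. A b q \<otimes> B q p)" for p
  have gc: "g p \<in> carrier R" if "p \<in> ?I" for p
    using that Bc A b by (auto simp: g_def intro!: finsum_closed)
  define y where "y p = (if p = b then \<one> else \<ominus> g p)" for p
  have yc: "y p \<in> carrier R" if "p \<in> S" for p using that gc by (simp add: y_def)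
  have "(\<Oplus>p\<in>S. y p \<otimes> A p q) = \<zero>" if q: "q \<in> ?I" for q
  proof -
    have "(\<Oplus>p\<in>?I. g p \<otimes> A p q) = (\<Oplus>q'\<in>?I. A b q' \<otimes> (\<Oplus>p\<in>?I. B q' p \<otimes> A p q))"
      unfolding g_def using fin q A Bc b by (subst finsum_assoc) auto
    also have "\<dots> = (\<Oplus>q'\<in>?I. A b q' \<otimes> (if q' = q then \<one> else \<zero>))"
      using q A b by (intro finsum_cong') (auto simp: BA)
    also have "\<dots> = A b q" using fin q A b by (intro finsum_unit_right) auto
    finally have gA: "(\<Oplus>p\<in>?I. g p \<otimes> A p q) = A b q" .
    have "(\<Oplus>p\<in>S. y p \<otimes> A p q) = A b q \<oplus> (\<Oplus>p\<in>?I. y p \<otimes> A p q)"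
      using fin b q yc A by (subst finsum_remove[of S b]) (auto simp: y_def)
    also have "(\<Oplus>p\<in>?I. y p \<otimes> A p q) = (\<Oplus>p\<in>?I. \<zero> \<ominus> g p \<otimes> A p q)"
      using q gc A by (intro finsum_cong') (auto simp: y_def minus_eq l_minus)
    also have "\<dots> = \<ominus> A b q"
      using q gc A gA b by (subst finsum_diff) (auto simp: minus_eq)
    finally show ?thesis using q A b by (simp add: r_neg)
  qed
  then show ?thesis
    using yc by (intro exI[of _ y]) (auto simp: y_def)
qed

end

section \<open>Null vectors modulo the ideal\<close>

context normal_nilpotent
begin

text \<open>
  With \<open>m = 1\<close> this is uniqueness of null vectors modulo the ideal: a congruence between two of them
  at \<open>b\<close> propagates to all indices.
\<close>

lemma column_in_T:
  assumes fin: "finite S" and b: "b \<in> S"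
    and A: "\<And>p q. p \<in> S \<Longrightarrow> q \<in> S \<Longrightarrow> A p q \<in> carrier R"
    and B: "is_mat_inverse R (S - {b}) (S - {b}) A B"
    and z: "\<And>q. q \<in> S \<Longrightarrow> z q \<in> carrier R" and zb: "z b \<in> T m"
    and Az: "\<And>p. p \<in> S - {b} \<Longrightarrow> (\<Oplus>q\<in>S. A p q \<otimes> z q) \<in> T m"
    and q: "q \<in> S"
  shows "z q \<in> T m"
proof (cases "q = b")
  case False
  let ?I = "S - {b}"
  have Bc: "B q p \<in> carrier R" if "p \<in> ?I" "q \<in> ?I" for p q
    using B that by (auto simp: is_mat_inverse_def)
  have BA: "(\<Oplus>p\<in>?I. B q p \<otimes> A p q') = (if q = q' then \<one> else \<zero>)" if "q \<in> ?I" "q' \<in> ?I" for q q'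
    using B that unfolding is_mat_inverse_def by blast
  have rest: "(\<Oplus>q\<in>?I. A p q \<otimes> z q) \<in> T m" if p: "p \<in> ?I" for p
  proof -
    have "(\<Oplus>q\<in>S. A p q \<otimes> z q) = A p b \<otimes> z b \<oplus> (\<Oplus>q\<in>?I. A p q \<otimes> z q)"
      using fin b p z A by (intro finsum_remove) auto
    moreover have "(\<Oplus>q\<in>?I. A p q \<otimes> z q) \<in> carrier R" "A p b \<otimes> z b \<in> carrier R"
      using p z A b by (auto intro!: finsum_closed)
    ultimately have "(\<Oplus>q\<in>?I. A p q \<otimes> z q) = (\<Oplus>q\<in>S. A p q \<otimes> z q) \<ominus> A p b \<otimes> z b"
      by (simp add: minus_eq a_ac r_neg r_neg1 r_neg2)
    then show ?thesis using Az[OF p] T_mult_left[OF A zb] p b T_minus by simp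
  qed
  have "z q = (\<Oplus>q'\<in>?I. (if q' = q then \<one> else \<zero>) \<otimes> z q')"
    using fin q False z by (subst finsum_unit_left) auto
  also have "\<dots> = (\<Oplus>q'\<in>?I. (\<Oplus>p\<in>?I. B q p \<otimes> A p q') \<otimes> z q')"
    using q False z by (intro finsum_cong') (auto simp: BA)
  also have "\<dots> = (\<Oplus>p\<in>?I. B q p \<otimes> (\<Oplus>q'\<in>?I. A p q' \<otimes> z q'))"
    using fin q False z A Bc by (subst finsum_assoc) auto
  also have "\<dots> \<in> T m"
    using Bc q False by (intro T_finsum T_mult_left[OF _ rest]) auto
  finally show ?thesis .
qed (use zb in simp)

lemma row_in_T:
  assumes fin: "finite S" and b: "b \<in> S"
    and A: "\<And>p q. p \<in> S \<Longrightarrow> q \<in> S \<Longrightarrow> A p q \<in> carrier R"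
    and B: "is_mat_inverse R (S - {b}) (S - {b}) A B"
    and z: "\<And>p. p \<in> S \<Longrightarrow> z p \<in> carrier R" and zb: "z b \<in> T m"
    and zA: "\<And>q. q \<in> S - {b} \<Longrightarrow> (\<Oplus>p\<in>S. z p \<otimes> A p q) \<in> T m"
    and p: "p \<in> S"
  shows "z p \<in> T m"
proof (cases "p = b")
  case False
  let ?I = "S - {b}"
  have Bc: "B q p \<in> carrier R" if "p \<in> ?I" "q \<in> ?I" for p q
    using B that by (auto simp: is_mat_inverse_def)
  have AB: "(\<Oplus>q\<in>?I. A p q \<otimes> B q p') = (if p = p' then \<one> else \<zero>)" if "p \<in> ?I" "p' \<in> ?I" for p p'
    using B that unfolding is_mat_inverse_def by blast
  have rest: "(\<Oplus>p\<in>?I. z p \<otimes> A p q) \<in> T m" if q: "q \<in> ?I" for q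
  proof -
    have "(\<Oplus>p\<in>S. z p \<otimes> A p q) = z b \<otimes> A b q \<oplus> (\<Oplus>p\<in>?I. z p \<otimes> A p q)"
      using fin b q z A by (intro finsum_remove) auto
    moreover have "(\<Oplus>p\<in>?I. z p \<otimes> A p q) \<in> carrier R" "z b \<otimes> A b q \<in> carrier R"
      using q z A b by (auto intro!: finsum_closed)
    ultimately have "(\<Oplus>p\<in>?I. z p \<otimes> A p q) = (\<Oplus>p\<in>S. z p \<otimes> A p q) \<ominus> z b \<otimes> A b q"
      by (simp add: minus_eq a_ac r_neg r_neg1 r_neg2)
    then show ?thesis using zA[OF q] T_mult_right[OF zb A] q b T_minus by simp
  qed
  have "z p = (\<Oplus>p'\<in>?I. z p' \<otimes> (if p' = p then \<one> else \<zero>))"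
    using fin p False z by (subst finsum_unit_right) auto
  also have "\<dots> = (\<Oplus>p'\<in>?I. z p' \<otimes> (\<Oplus>q\<in>?I. A p' q \<otimes> B q p))"
    using p False z by (intro finsum_cong') (auto simp: AB)
  also have "\<dots> = (\<Oplus>q\<in>?I. (\<Oplus>p'\<in>?I. z p' \<otimes> A p' q) \<otimes> B q p)"
    using fin p False z A Bc by (intro finsum_assoc) auto
  also have "\<dots> \<in> T m"
    using Bc p False by (intro T_finsum T_mult_right[OF rest]) auto
  finally show ?thesis .
qed (use zb in simp)

end

section \<open>Cyclic linear systems\<close>

text \<open>
  The linear system of a coloring, with the arcs replaced by abstract indices: \<open>pr\<close> is the preceding
  arc, \<open>opp\<close> the arc that leaves the same crossing along the other strand, and \<open>\<alpha>\<close>, \<open>\<beta>\<close> are the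
  coefficients of the two arcs that enter. The assumption on \<open>ord\<close> says that \<open>pr\<close> has a
  single cycle: after deletion of \<open>b\<close> the remaining indices can be numbered compatibly with it. The
  weights \<open>w\<close> solve all the equations modulo the ideal, without exception at a base point.
\<close>

locale cyclic_system = normal_nilpotent R t N for R (structure) and t and N :: nat +
  fixes S :: "'i set" and pr opp :: "'i \<Rightarrow> 'i" and \<alpha> \<beta> w :: "'i \<Rightarrow> 'a"
  assumes fin: "finite S"
    and pr: "bij_betw pr S S"
    and cyclic: "b \<in> S \<Longrightarrow> \<exists>ord::'i \<Rightarrow> nat. \<forall>p\<in>S - {b}. pr p \<noteq> b \<longrightarrow> ord (pr p) < ord p"
    and opp: "p \<in> S \<Longrightarrow> opp p \<in> S"
    and \<alpha>: "p \<in> S \<Longrightarrow> \<alpha> p \<in> carrier R"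
    and \<beta>: "p \<in> S \<Longrightarrow> \<beta> p \<in> T 1"
    and w: "p \<in> S \<Longrightarrow> w p \<in> Units R"
    and height: "p \<in> S \<Longrightarrow> \<alpha> p \<otimes> w (pr p) \<oplus> w p \<in> T 1"
begin

definition M :: "'i \<Rightarrow> 'i \<Rightarrow> 'a" where
  "M p q = delta q p \<oplus> \<alpha> p \<otimes> delta q (pr p) \<oplus> \<beta> p \<otimes> delta q (pr (opp p))"

lemma pr_S: "p \<in> S \<Longrightarrow> pr p \<in> S"
  using pr by (rule bij_betwE[THEN bspec])

lemma \<beta>_closed: "p \<in> S \<Longrightarrow> \<beta> p \<in> carrier R"
  using \<beta> T_closed by blast

lemma w_closed: "p \<in> S \<Longrightarrow> w p \<in> carrier R"
  using w by blast

lemma M_closed: "p \<in> S \<Longrightarrow> q \<in> S \<Longrightarrow> M p q \<in> carrier R"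
  by (simp add: M_def \<alpha> \<beta>_closed)

lemma M_row:
  assumes p: "p \<in> S" and x: "\<And>q. q \<in> S \<Longrightarrow> x q \<in> carrier R"
  shows "(\<Oplus>q\<in>S. M p q \<otimes> x q) = x p \<oplus> \<alpha> p \<otimes> x (pr p) \<oplus> \<beta> p \<otimes> x (pr (opp p))"
proof -
  have "(\<Oplus>q\<in>S. M p q \<otimes> x q) = (\<Oplus>q\<in>S. delta q p \<otimes> x q \<oplus> \<alpha> p \<otimes> (delta q (pr p) \<otimes> x q)
      \<oplus> \<beta> p \<otimes> (delta q (pr (opp p)) \<otimes> x q))"
  proof (rule finsum_cong')
    fix q assume "q \<in> S"
    then show "M p q \<otimes> x q = delta q p \<otimes> x q \<oplus> \<alpha> p \<otimes> (delta q (pr p) \<otimes> x q)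
        \<oplus> \<beta> p \<otimes> (delta q (pr (opp p)) \<otimes> x q)"
      using p x \<alpha> \<beta>_closed by (simp add: M_def l_distr m_assoc del: r_one l_one r_null l_null)
  qed (use p x \<alpha> \<beta>_closed in auto)
  also have "\<dots> = (\<Oplus>q\<in>S. delta q p \<otimes> x q) \<oplus> \<alpha> p \<otimes> (\<Oplus>q\<in>S. delta q (pr p) \<otimes> x q)
      \<oplus> \<beta> p \<otimes> (\<Oplus>q\<in>S. delta q (pr (opp p)) \<otimes> x q)"
    using p x \<alpha> \<beta>_closed fin by (simp add: finsum_addf finsum_rdistr Pi_def)
  finally show ?thesis
    using p x fin by (simp add: finsum_unit_left pr_S opp Pi_def)
qed

lemma M_off_pred:
  assumes "p \<in> S" "q \<in> S" "q \<noteq> pr p"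
  shows "M p q \<ominus> delta p q \<in> T 1"
proof -
  have "M p q \<ominus> delta p q = \<beta> p \<otimes> delta q (pr (opp p))"
    using assms \<alpha> \<beta>_closed by (auto simp: M_def minus_eq r_neg l_neg a_comm[of \<one>] a_assoc)
  then show ?thesis using assms \<beta> T_mult_right by simp
qed

lemma M_minor_invertible:
  assumes b: "b \<in> S"
  shows "\<exists>B. is_mat_inverse R (S - {b}) (S - {b}) M B"
proof -
  obtain ord :: "'i \<Rightarrow> nat" where ord: "\<And>p. p \<in> S - {b} \<Longrightarrow> pr p \<noteq> b \<Longrightarrow> ord (pr p) < ord p"
    using cyclic[OF b] by blast
  have "M p q \<ominus> delta p q \<in> T 1" if "p \<in> S - {b}" "q \<in> S - {b}" "ord p \<le> ord q" for p q
    using M_off_pred[of p q] ord[of p] that by force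
  then have "unitriangular ord (S - {b}) M"
    using M_closed by (auto simp: unitriangular_def)
  then show ?thesis using fin unitriangular_invertible by blast
qed

text \<open>
  The vector \<open>w\<close>, normalised at \<open>b\<close>, is also a null vector modulo the ideal.
\<close>

lemma right_null_vector_height:
  assumes b: "b \<in> S" and x: "\<And>q. q \<in> S \<Longrightarrow> x q \<in> carrier R" and xb: "x b = \<one>"
    and Mx: "\<And>p. p \<in> S - {b} \<Longrightarrow> (\<Oplus>q\<in>S. M p q \<otimes> x q) = \<zero>"
    and q: "q \<in> S"
  shows "x q \<ominus> w q \<otimes> inv (w b) \<in> T 1"
proof -
  obtain B where B: "is_mat_inverse R (S - {b}) (S - {b}) M B"
    using M_minor_invertible[OF b] by blast
  have wb: "inv (w b) \<in> carrier R" using w[OF b] by simp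
  define z where "z q = w q \<otimes> inv (w b)" for q
  have zc: "z q \<in> carrier R" if "q \<in> S" for q using that w_closed wb by (simp add: z_def)
  have Mz: "(\<Oplus>q\<in>S. M p q \<otimes> z q) \<in> T 1" if p: "p \<in> S" for p
  proof -
    have c: "\<alpha> p \<in> carrier R" "w p \<in> carrier R" "w (pr p) \<in> carrier R"
      using p \<alpha> w_closed pr_S by auto
    have "(\<Oplus>q\<in>S. M p q \<otimes> z q) =
        (\<alpha> p \<otimes> w (pr p) \<oplus> w p) \<otimes> inv (w b) \<oplus> \<beta> p \<otimes> z (pr (opp p))"
      using c wb p \<beta>_closed zc pr_S opp
      by (subst M_row[of p z]) (auto simp: z_def l_distr m_assoc a_ac)
    also have "\<dots> \<in> T 1"
      using p pr_S opp zc
      by (intro T_add[OF T_mult_right[OF height[OF p] wb] T_mult_right[OF \<beta>[OF p]]]) auto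
    finally show ?thesis .
  qed
  have "x q \<ominus> z q \<in> T 1"
  proof (rule column_in_T[OF fin b M_closed B _ _ _ q, where z = "\<lambda>q. x q \<ominus> z q"])
    show "x b \<ominus> z b \<in> T 1"
      using w[OF b] by (simp add: xb z_def minus_eq r_neg)
    fix p assume p: "p \<in> S - {b}"
    have "(\<Oplus>q\<in>S. M p q \<otimes> (x q \<ominus> z q)) = (\<Oplus>q\<in>S. M p q \<otimes> x q \<ominus> M p q \<otimes> z q)"
      using p M_closed x zc by (intro finsum_cong') (auto simp: minus_eq r_distr r_minus)
    also have "\<dots> = \<zero> \<ominus> (\<Oplus>q\<in>S. M p q \<otimes> z q)"
      using p M_closed x zc by (subst finsum_diff) (auto simp: Mx)
    also have "\<dots> \<in> T 1" using Mz p by (intro T_minus) auto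
    finally show "(\<Oplus>q\<in>S. M p q \<otimes> (x q \<ominus> z q)) \<in> T 1" .
  qed (use x zc in auto)
  then show ?thesis by (simp add: z_def)
qed

lemma height_inverse:
  assumes p: "p \<in> S"
  shows "inv (w p) \<otimes> \<alpha> p \<oplus> inv (w (pr p)) \<in> T 1"
proof -
  have c: "\<alpha> p \<in> carrier R" "w p \<in> carrier R" "w (pr p) \<in> carrier R"
    "inv (w p) \<in> carrier R" "inv (w (pr p)) \<in> carrier R"
    using p \<alpha> w pr_S by auto
  have "inv (w p) \<otimes> (\<alpha> p \<otimes> w (pr p) \<oplus> w p) \<otimes> inv (w (pr p)) =
      inv (w p) \<otimes> \<alpha> p \<otimes> (w (pr p) \<otimes> inv (w (pr p))) \<oplus> (inv (w p) \<otimes> w p) \<otimes> inv (w (pr p))"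
    using c by (simp only: r_distr l_distr m_assoc m_closed)
  also have "\<dots> = inv (w p) \<otimes> \<alpha> p \<oplus> inv (w (pr p))"
    using p w pr_S c by simp
  finally show ?thesis
    using T_mult_right[OF T_mult_left[OF c(4) height[OF p]] c(5)] by simp
qed

text \<open>
  Modulo the ideal, the column of \<open>q\<close> involves only \<open>q\<close> and the index that follows \<open>q\<close>, and the
  inverses of the weights satisfy its equation.
\<close>

lemma left_null_vector_height:
  assumes b: "b \<in> S" and y: "\<And>p. p \<in> S \<Longrightarrow> y p \<in> carrier R" and yb: "y b = \<one>"
    and yM: "\<And>q. q \<in> S - {b} \<Longrightarrow> (\<Oplus>p\<in>S. y p \<otimes> M p q) = \<zero>"
    and p: "p \<in> S"
  shows "y p \<ominus> w b \<otimes> inv (w p) \<in> T 1"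
proof -
  obtain B where B: "is_mat_inverse R (S - {b}) (S - {b}) M B"
    using M_minor_invertible[OF b] by blast
  define z where "z p = w b \<otimes> inv (w p)" for p
  have zc: "z p \<in> carrier R" if "p \<in> S" for p using that w_closed[OF b] w by (simp add: z_def)
  have step: "z p \<otimes> \<alpha> p \<oplus> z (pr p) \<in> T 1" if p: "p \<in> S" for p
  proof -
    have "z p \<otimes> \<alpha> p \<oplus> z (pr p) = w b \<otimes> (inv (w p) \<otimes> \<alpha> p \<oplus> inv (w (pr p)))"
      using p b w_closed w \<alpha> pr_S by (simp add: z_def r_distr m_assoc)
    then show ?thesis using height_inverse[OF p] w_closed[OF b] T_mult_left by simp
  qed
  have zM: "(\<Oplus>p\<in>S. z p \<otimes> M p q) \<in> T 1" if q: "q \<in> S" for q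
  proof -
    obtain n where n: "n \<in> S" "pr n = q" using q bij_betw_imp_surj_on[OF pr] by (metis imageE)
    have n_iff: "q = pr p \<longleftrightarrow> p = n" if "p \<in> S" for p
      using that n pr by (auto simp: bij_betw_def inj_on_def)
    \<comment> \<open>Modulo the ideal, only \<open>q\<close> and its successor \<open>n\<close> contribute to the sum, with opposite terms.\<close>
    define v where "v p = z p \<otimes> delta p q \<ominus> z (pr p) \<otimes> delta p n" for p
    have vc: "v p \<in> carrier R" if "p \<in> S" for p using that zc pr_S by (simp add: v_def)
    have "(\<Oplus>p\<in>S. v p) = z q \<ominus> z (pr n)"
      unfolding v_def using fin q n zc pr_S
      by (subst finsum_diff) (auto simp: finsum_unit_right)
    then have v0: "(\<Oplus>p\<in>S. v p) = \<zero>" using n zc q by (simp add: minus_eq r_neg)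
    have term_T: "z p \<otimes> M p q \<ominus> v p \<in> T 1" if p: "p \<in> S" for p
    proof -
      have rearrange: "a \<otimes> (d \<oplus> c \<otimes> d' \<oplus> e) \<ominus> (a \<otimes> d \<ominus> a' \<otimes> d') = (a \<otimes> c \<oplus> a') \<otimes> d' \<oplus> a \<otimes> e"
        if "a \<in> carrier R" "a' \<in> carrier R" "c \<in> carrier R" "d \<in> carrier R" "d' \<in> carrier R"
          "e \<in> carrier R" for a a' c d d' e
        using that by algebra
      have d: "delta q (pr p) = delta p n" "delta q p = delta p q" using n_iff[OF p] by auto
      have "z p \<otimes> M p q \<ominus> v p = (z p \<otimes> \<alpha> p \<oplus> z (pr p)) \<otimes> delta p n
          \<oplus> z p \<otimes> (\<beta> p \<otimes> delta q (pr (opp p)))"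
        unfolding M_def v_def d using p zc \<alpha> \<beta>_closed pr_S by (intro rearrange) auto
      also have "\<dots> \<in> T 1"
        by (intro T_add[OF T_mult_right[OF step[OF p]]
              T_mult_left[OF zc[OF p] T_mult_right[OF \<beta>[OF p]]]]) auto
      finally show ?thesis .
    qed
    have "(\<Oplus>p\<in>S. z p \<otimes> M p q) = (\<Oplus>p\<in>S. z p \<otimes> M p q) \<ominus> (\<Oplus>p\<in>S. v p)"
      unfolding v0 using q zc M_closed by (simp add: minus_eq Pi_def)
    also have "\<dots> = (\<Oplus>p\<in>S. z p \<otimes> M p q \<ominus> v p)"
      using q zc vc M_closed by (subst finsum_diff) auto
    also have "\<dots> \<in> T 1" using term_T by (rule T_finsum)
    finally show ?thesis .
  qed
  have "y p \<ominus> z p \<in> T 1"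
  proof (rule row_in_T[OF fin b M_closed B _ _ _ p, where z = "\<lambda>p. y p \<ominus> z p"])
    show "y b \<ominus> z b \<in> T 1"
      using w[OF b] by (simp add: yb z_def minus_eq r_neg)
    fix q assume q: "q \<in> S - {b}"
    have "(\<Oplus>p\<in>S. (y p \<ominus> z p) \<otimes> M p q) = (\<Oplus>p\<in>S. y p \<otimes> M p q \<ominus> z p \<otimes> M p q)"
      using q M_closed y zc by (intro finsum_cong') (auto simp: minus_eq l_distr l_minus)
    also have "\<dots> = \<zero> \<ominus> (\<Oplus>p\<in>S. z p \<otimes> M p q)"
      using q M_closed y zc by (subst finsum_diff) (auto simp: yM)
    also have "\<dots> \<in> T 1" using zM q by (intro T_minus) auto
    finally show "(\<Oplus>p\<in>S. (y p \<ominus> z p) \<otimes> M p q) \<in> T 1" .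
  qed (use y zc in auto)
  then show ?thesis by (simp add: z_def)
qed

text \<open>
  For any \<open>u\<close> with \<open>M u\<close> concentrated in row \<open>c\<close>, associativity of \<open>y M u\<close> equates the
  entry of \<open>y M\<close> at \<open>b\<close> times \<open>u b\<close> with \<open>y c\<close> times the value of \<open>u\<close>. The cases \<open>u = x\<close>
  and \<open>u = x'\<close> together relate the two values.
\<close>

lemma null_vector_values_equivalent:
  assumes b: "b \<in> S" and x: "\<And>q. q \<in> S \<Longrightarrow> x q \<in> carrier R" and xb: "x b = \<one>"
    and Mx: "\<And>p. p \<in> S - {b} \<Longrightarrow> (\<Oplus>q\<in>S. M p q \<otimes> x q) = \<zero>"
    and b': "b' \<in> S" and x': "\<And>q. q \<in> S \<Longrightarrow> x' q \<in> carrier R" and xb': "x' b' = \<one>"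
    and Mx': "\<And>p. p \<in> S - {b'} \<Longrightarrow> (\<Oplus>q\<in>S. M p q \<otimes> x' q) = \<zero>"
  shows "\<exists>U\<in>Units R. \<exists>W\<in>Units R. U \<otimes> W \<ominus> \<one> \<in> T 1 \<and>
    (\<Oplus>q\<in>S. M b' q \<otimes> x' q) = U \<otimes> (\<Oplus>q\<in>S. M b q \<otimes> x q) \<otimes> W"
proof -
  let ?v = "\<Oplus>q\<in>S. M b q \<otimes> x q" and ?v' = "\<Oplus>q\<in>S. M b' q \<otimes> x' q"
  obtain B where B: "is_mat_inverse R (S - {b}) (S - {b}) M B"
    using M_minor_invertible[OF b] by blast
  obtain y where y: "\<And>p. p \<in> S \<Longrightarrow> y p \<in> carrier R" and yb: "y b = \<one>"
    and yM: "\<And>q. q \<in> S - {b} \<Longrightarrow> (\<Oplus>p\<in>S. y p \<otimes> M p q) = \<zero>"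
    using left_null_vector[OF fin b M_closed B] by blast
  have vc: "?v \<in> carrier R" "?v' \<in> carrier R"
    using b b' x x' M_closed by (auto intro!: finsum_closed)
  have pairing: "(\<Oplus>p\<in>S. y p \<otimes> M p b) \<otimes> u b = y c \<otimes> (\<Oplus>q\<in>S. M c q \<otimes> u q)"
    if c: "c \<in> S" and u: "\<And>q. q \<in> S \<Longrightarrow> u q \<in> carrier R"
      and Mu: "\<And>p. p \<in> S - {c} \<Longrightarrow> (\<Oplus>q\<in>S. M p q \<otimes> u q) = \<zero>" for c u
  proof -
    have cl: "(\<Oplus>q\<in>S. M p q \<otimes> u q) \<in> carrier R" "(\<Oplus>p'\<in>S. y p' \<otimes> M p' p) \<in> carrier R"
      if "p \<in> S" for p
      using that u y M_closed by (auto intro!: finsum_closed)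
    have "(\<Oplus>q\<in>S - {b}. (\<Oplus>p\<in>S. y p \<otimes> M p q) \<otimes> u q) = \<zero>"
      by (rule add.finprod_one_eqI) (use yM u in auto)
    then have "(\<Oplus>p\<in>S. y p \<otimes> M p b) \<otimes> u b
        = (\<Oplus>q\<in>S. (\<Oplus>p\<in>S. y p \<otimes> M p q) \<otimes> u q)"
      using fin b u cl
      by (subst finsum_remove[of S b "\<lambda>q. (\<Oplus>p\<in>S. y p \<otimes> M p q) \<otimes> u q"]) auto
    also have "\<dots> = (\<Oplus>p\<in>S. y p \<otimes> (\<Oplus>q\<in>S. M p q \<otimes> u q))"
      using fin y u M_closed by (intro finsum_assoc[symmetric]) auto
    also have "\<dots> = y c \<otimes> (\<Oplus>q\<in>S. M c q \<otimes> u q)"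
    proof -
      have "(\<Oplus>p\<in>S - {c}. y p \<otimes> (\<Oplus>q\<in>S. M p q \<otimes> u q)) = \<zero>"
        by (rule add.finprod_one_eqI) (use y Mu in auto)
      then show ?thesis using fin c y cl
        by (subst finsum_remove[of S c "\<lambda>p. y p \<otimes> (\<Oplus>q\<in>S. M p q \<otimes> u q)"]) auto
    qed
    finally show ?thesis .
  qed
  let ?u = "w b \<otimes> inv (w b')"
  have u: "?u \<in> Units R" using w b b' by auto
  have yu: "y b' \<ominus> ?u \<in> T 1" by (rule left_null_vector_height[OF b y yb yM b'])
  have xu: "x' b \<ominus> ?u \<in> T 1" by (rule right_null_vector_height[OF b' x' xb' Mx' b])
  have units: "y b' \<in> Units R" "x' b \<in> Units R"
    using unit_plus_T[OF u _ yu] unit_plus_T[OF u _ xu] y x' b b' by auto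
  have c: "y b' \<in> carrier R" "x' b \<in> carrier R" "?u \<in> carrier R" "inv (y b') \<in> carrier R"
    using units u by auto
  have "?v = (\<Oplus>p\<in>S. y p \<otimes> M p b)"
    using pairing[OF b x Mx] xb yb y b M_closed vc by (simp add: Pi_def)
  then have "y b' \<otimes> ?v' = ?v \<otimes> x' b"
    using pairing[OF b' x' Mx'] by simp
  then have "inv (y b') \<otimes> ?v \<otimes> x' b = inv (y b') \<otimes> y b' \<otimes> ?v'"
    using c vc by (simp add: m_assoc)
  then have eq: "?v' = inv (y b') \<otimes> ?v \<otimes> x' b"
    using units vc by simp
  have "x' b \<ominus> y b' = (x' b \<ominus> ?u) \<ominus> (y b' \<ominus> ?u)"
  proof -
    have "g \<ominus> h = (g \<ominus> u) \<ominus> (h \<ominus> u)"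
      if "g \<in> carrier R" "h \<in> carrier R" "u \<in> carrier R" for g h u
      using that by algebra
    then show ?thesis using c by blast
  qed
  then have "inv (y b') \<otimes> (x' b \<ominus> y b') \<in> T 1"
    using xu yu c by (metis T_minus T_mult_left)
  also have "inv (y b') \<otimes> (x' b \<ominus> y b') = inv (y b') \<otimes> x' b \<ominus> \<one>"
    using c units by (simp add: minus_eq r_distr r_minus)
  finally show ?thesis
    using units eq by (intro bexI[of _ "inv (y b')"] bexI[of _ "x' b"]) auto
qed

end

section \<open>The rings \<open>S_ring n\<close>\<close>

lemma free_ring_sel [simp]:
  "carrier free_ring = UNIV" "mult free_ring = (*)" "one free_ring = 1" "zero free_ring = 0"
  "add free_ring = (+)"
  by (simp_all add: free_ring_def)

lemma S_class_hom: "S_class n \<in> ring_hom free_ring (S_ring n)"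
  unfolding S_class_def S_ring_def using ideal.rcos_ring_hom[OF ideal_S_ideal] by simp

lemma S_class_closed [simp]: "S_class n x \<in> carrier (S_ring n)"
  using ring_hom_closed[OF S_class_hom, of x n] by simp

lemma S_class_mult: "S_class n (x * y) = S_class n x \<otimes>\<^bsub>S_ring n\<^esub> S_class n y"
  using ring_hom_mult[OF S_class_hom, of x y n] by simp

lemma S_class_add: "S_class n (x + y) = S_class n x \<oplus>\<^bsub>S_ring n\<^esub> S_class n y"
  using ring_hom_add[OF S_class_hom, of x y n] by simp

lemma S_class_one: "S_class n 1 = \<one>\<^bsub>S_ring n\<^esub>"
  using ring_hom_one[OF S_class_hom, of n] by simp

lemma S_class_power: "S_class n (x ^ m) = S_class n x [^]\<^bsub>S_ring n\<^esub> m"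
proof (induction m)
  case (Suc m)
  then show ?case unfolding power_Suc2 S_class_mult by simp
qed (simp add: S_class_one)

lemma S_class_eq_iff: "S_class n x = S_class n y \<longleftrightarrow> x - y \<in> S_ideal n"
proof -
  interpret I: ideal "S_ideal n" free_ring by (rule ideal_S_ideal)
  have cls: "S_class n z = (\<lambda>h. h + z) ` S_ideal n" for z
    by (auto simp: S_class_def a_r_coset_def r_coset_def)
  have z: "0 \<in> S_ideal n"
    using additive_subgroup.zero_closed[OF ideal.axioms(1)[OF ideal_S_ideal]] by simp
  have ad: "a + c \<in> S_ideal n" if "a \<in> S_ideal n" "c \<in> S_ideal n" for a c
    using additive_subgroup.a_closed[OF ideal.axioms(1)[OF ideal_S_ideal] that] by simp
  have ng: "- a \<in> S_ideal n" if "a \<in> S_ideal n" for a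
    using I.I_l_closed[OF that, of "-1"] by simp
  show ?thesis
  proof
    assume "S_class n x = S_class n y"
    then have "x \<in> S_class n y" using imageI[OF z, of "\<lambda>h. h + x"] unfolding cls by simp
    then show "x - y \<in> S_ideal n" unfolding cls by auto
  next
    assume d: "x - y \<in> S_ideal n"
    have sub: "S_class n a \<subseteq> S_class n c" if "a - c \<in> S_ideal n" for a c
    proof
      fix v assume "v \<in> S_class n a"
      then obtain h where h: "h \<in> S_ideal n" "v = h + a" unfolding cls by blast
      then have "v = (h + (a - c)) + c" by simp
      then show "v \<in> S_class n c" unfolding cls using ad[OF h(1) that] by blast
    qed
    show "S_class n x = S_class n y"
      using sub[OF d] sub[of y x] ng[OF d] by auto
  qed
qed

lemma S_class_surj: "X \<in> carrier (S_ring n) \<Longrightarrow> \<exists>x. X = S_class n x"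
  by (auto simp: S_ring_def S_class_def FactRing_def A_RCOSETS_defs a_r_coset_def r_coset_def)

lemma S_relators_subset: "S_relators n \<subseteq> S_ideal n"
  unfolding S_ideal_def by (rule ring.genideal_self[OF ring_free_ring]) simp

lemma S_zero: "S_class n 0 = \<zero>\<^bsub>S_ring n\<^esub>"
proof -
  interpret R: ring "S_ring n" by (rule ring_S_ring)
  have "S_class n 0 \<oplus>\<^bsub>S_ring n\<^esub> S_class n 0 = S_class n 0" using S_class_add[of n 0 0] by simp
  then show ?thesis by (simp add: R.add.l_cancel_one)
qed

lemma S_relations:
  defines "s \<equiv> gen Gen_s" and "s' \<equiv> gen Gen_sbar" and "t \<equiv> gen Gen_t"
  shows "S_class n (s * s') = S_class n 1" "S_class n (s' * s) = S_class n 1"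
    "S_class n (t * s) = S_class n (s * (\<Sum>i=1..n. t ^ i))"
    "S_class n (t * s') = S_class n (s' * (\<Sum>i=1..n. (-1) ^ (i - 1) * t ^ i))"
    "S_class n (t ^ (n + 1)) = S_class n 0"
  using S_relators_subset[of n]
  by (simp_all add: S_class_eq_iff S_relators_def Let_def s_def s'_def t_def)

text \<open>Words are products of generators, and every element is an integer combination of words.\<close>

lemma free_alg_induct [case_names gen one mult add neg]:
  assumes gen: "\<And>g. P (gen g)" and one: "P (1 :: free_alg)"
    and mult: "\<And>x y. P x \<Longrightarrow> P y \<Longrightarrow> P (x * y)"
    and add: "\<And>x y. P x \<Longrightarrow> P y \<Longrightarrow> P (x + y)"
    and neg: "\<And>x. P x \<Longrightarrow> P (- x)"
  shows "P x"
proof -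
  have zero: "P 0" using add[OF one neg[OF one]] by simp
  have word: "P (Poly_Mapping.single (Word l) 1)" for l
  proof (induction l)
    case Nil
    then show ?case using one by (simp flip: zero_word_def)
  next
    case (Cons g l)
    have "Poly_Mapping.single (Word (g # l)) 1 = gen g * Poly_Mapping.single (Word l) 1"
      by (simp add: gen_def mult_single plus_word_def)
    then show ?case using mult[OF gen Cons.IH] by simp
  qed
  have nat: "P (Poly_Mapping.single v (int m))" for v m
  proof (induction m)
    case (Suc m)
    have "Poly_Mapping.single v (int (Suc m)) = Poly_Mapping.single v 1 + Poly_Mapping.single v (int m)"
      by (simp flip: single_add)
    then show ?case using add[OF word[of "letters v"] Suc.IH] by simp
  qed (simp add: zero)
  have sgl: "P (Poly_Mapping.single v c)" for v c
  proof (cases c)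
    case (neg m)
    then show ?thesis using assms(5)[OF nat[of v "Suc m"]] by (simp only: single_uminus)
  qed (simp add: nat)
  show ?thesis
  proof (induction x rule: update_induct)
    case const
    then show ?case using zero by simp
  next
    case (update f a b)
    have "Poly_Mapping.update a b f = f + Poly_Mapping.single a b"
      using update by (intro poly_mapping_eqI)
        (auto simp: lookup_update lookup_add lookup_single when_def in_keys_iff)
    then show ?case using add[OF update(3) sgl] by simp
  qed
qed

text \<open>
  The elements \<open>x\<close> with \<open>t x \<in> R t\<close> form a subring, which contains the generators because
  the sums in the commutation relations start with the first power of \<open>t\<close>.
\<close>

lemma t_normal:
  "\<exists>y. S_class n (gen Gen_t * x) = S_class n (y * gen Gen_t)"
proof (induction x rule: free_alg_induct)
  case (gen g)
  let ?t = "gen Gen_t"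
  have factor: "x * (\<Sum>i=1..n. f i * ?t ^ i) = (x * (\<Sum>i=1..n. f i * ?t ^ (i - 1))) * ?t"
    for x and f :: "nat \<Rightarrow> free_alg"
  proof -
    have "(\<Sum>i=1..n. f i * ?t ^ i) = (\<Sum>i=1..n. f i * ?t ^ (i - 1) * ?t)"
      by (rule sum.cong) (auto simp: mult.assoc power_Suc2[symmetric] simp del: power_Suc)
    then show ?thesis by (simp add: sum_distrib_right mult.assoc)
  qed
  show ?case
  proof (cases g)
    case Gen_s
    then show ?thesis
      using S_relations(3)[of n] factor[of "gen Gen_s" "\<lambda>_. 1"] by (auto intro!: exI)
  next
    case Gen_sbar
    then show ?thesis
      using S_relations(4)[of n] unfolding factor by (auto intro!: exI)
  qed blast
next
  case (mult x y)
  then obtain u v where u: "S_class n (gen Gen_t * x) = S_class n (u * gen Gen_t)"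
    and v: "S_class n (gen Gen_t * y) = S_class n (v * gen Gen_t)" by blast
  have "S_class n (gen Gen_t * (x * y)) = S_class n (u * v * gen Gen_t)"
  proof -
    interpret R: ring "S_ring n" by (rule ring_S_ring)
    have "S_class n (gen Gen_t * (x * y)) = S_class n (gen Gen_t * x) \<otimes>\<^bsub>S_ring n\<^esub> S_class n y"
      by (simp flip: S_class_mult add: mult.assoc)
    also have "\<dots> = S_class n u \<otimes>\<^bsub>S_ring n\<^esub> S_class n (gen Gen_t * y)"
      unfolding u by (simp add: S_class_mult R.m_assoc)
    also have "\<dots> = S_class n (u * v * gen Gen_t)"
      unfolding v by (simp add: S_class_mult R.m_assoc)
    finally show ?thesis .
  qed
  then show ?case by blast
next
  case (add x y)
  then obtain u v where u: "S_class n (gen Gen_t * x) = S_class n (u * gen Gen_t)"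
    and v: "S_class n (gen Gen_t * y) = S_class n (v * gen Gen_t)" by blast
  have "S_class n (gen Gen_t * (x + y)) = S_class n ((u + v) * gen Gen_t)"
    by (simp only: distrib_left distrib_right S_class_add u v)
  then show ?case by blast
next
  case (neg x)
  then obtain u where u: "S_class n (gen Gen_t * x) = S_class n (u * gen Gen_t)" by blast
  have "S_class n (gen Gen_t * - x) = S_class n (- 1 * (gen Gen_t * x))" by simp
  also have "\<dots> = S_class n (- 1 * (u * gen Gen_t))" by (simp only: S_class_mult[of n "-1"] u)
  also have "\<dots> = S_class n (- u * gen Gen_t)" by simp
  finally show ?case by blast
qed (auto intro!: exI[of _ 1])

lemma S_ring_normal_nilpotent: "normal_nilpotent (S_ring n) (t_elt n) (n + 1)"
proof -
  interpret ring "S_ring n" by (rule ring_S_ring)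
  show ?thesis
  proof
    show "t_elt n \<in> carrier (S_ring n)" by (simp add: t_elt_def)
    show "t_elt n [^]\<^bsub>S_ring n\<^esub> (n + 1) = \<zero>\<^bsub>S_ring n\<^esub>"
      using S_relations(5)[of n] unfolding S_class_power S_zero t_elt_def .
    fix r assume "r \<in> carrier (S_ring n)"
    then obtain x where r: "r = S_class n x" using S_class_surj by blast
    obtain y where "S_class n (gen Gen_t * x) = S_class n (y * gen Gen_t)" using t_normal by blast
    then show "\<exists>r'\<in>carrier (S_ring n). t_elt n \<otimes>\<^bsub>S_ring n\<^esub> r = r' \<otimes>\<^bsub>S_ring n\<^esub> t_elt n"
      unfolding r t_elt_def S_class_mult by (intro bexI[of _ "S_class n y"]) auto
  qed
qed

lemma s_elt_inverse:
  "s_elt n \<otimes>\<^bsub>S_ring n\<^esub> sinv_elt n = \<one>\<^bsub>S_ring n\<^esub>" "sinv_elt n \<otimes>\<^bsub>S_ring n\<^esub> s_elt n = \<one>\<^bsub>S_ring n\<^esub>"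
  using S_relations(1,2)[of n] by (simp_all add: s_elt_def sinv_elt_def S_class_mult S_class_one)

lemma S_elt_closed [simp]:
  "s_elt n \<in> carrier (S_ring n)" "sinv_elt n \<in> carrier (S_ring n)" "t_elt n \<in> carrier (S_ring n)"
  by (simp_all add: s_elt_def sinv_elt_def t_elt_def)

lemma S_proj0_eq_one:
  assumes x: "x \<in> carrier (S_ring n)"
    and xT: "x \<ominus>\<^bsub>S_ring n\<^esub> \<one>\<^bsub>S_ring n\<^esub> \<in> normal_nilpotent.T (S_ring n) (t_elt n) 1"
  shows "S_proj0 n x = \<one>\<^bsub>S_ring 0\<^esub>"
proof -
  interpret R: normal_nilpotent "S_ring n" "t_elt n" "n + 1" by (rule S_ring_normal_nilpotent)
  interpret R0: ring "S_ring 0" by (rule ring_S_ring)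
  have hom: "S_proj0 n \<in> ring_hom (S_ring n) (S_ring 0)" and t0: "S_proj0 n (t_elt n) = \<zero>\<^bsub>S_ring 0\<^esub>"
    using is_S_proj0[of n] by (auto simp: is_S_proj0_def)
  obtain r where r: "r \<in> carrier (S_ring n)" "x \<ominus>\<^bsub>S_ring n\<^esub> \<one>\<^bsub>S_ring n\<^esub> = r \<otimes>\<^bsub>S_ring n\<^esub> t_elt n"
    using xT by (auto simp: R.T_def)
  have "x = (x \<ominus>\<^bsub>S_ring n\<^esub> \<one>\<^bsub>S_ring n\<^esub>) \<oplus>\<^bsub>S_ring n\<^esub> \<one>\<^bsub>S_ring n\<^esub>"
    using x by (simp add: R.minus_eq R.a_assoc R.l_neg)
  then have "S_proj0 n x = S_proj0 n (r \<otimes>\<^bsub>S_ring n\<^esub> t_elt n \<oplus>\<^bsub>S_ring n\<^esub> \<one>\<^bsub>S_ring n\<^esub>)"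
    using r by simp
  also have "\<dots> = S_proj0 n r \<otimes>\<^bsub>S_ring 0\<^esub> \<zero>\<^bsub>S_ring 0\<^esub> \<oplus>\<^bsub>S_ring 0\<^esub> \<one>\<^bsub>S_ring 0\<^esub>"
    using r t0 by (simp add: ring_hom_add[OF hom] ring_hom_mult[OF hom] ring_hom_one[OF hom])
  also have "\<dots> = \<one>\<^bsub>S_ring 0\<^esub>" using ring_hom_closed[OF hom r(1)] by simp
  finally show ?thesis .
qed

section \<open>Cyclic order on finite sets of parameters\<close>

definition cyclic_pred :: "'a::linorder set \<Rightarrow> 'a \<Rightarrow> 'a" where
  "cyclic_pred S p = (if \<exists>q\<in>S. q < p then Max {q \<in> S. q < p} else Max S)"

text \<open>
  The initial point of the arc that contains \<open>p\<close>, when the circle is cut at the points of \<open>S\<close>; below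
  the least element of \<open>S\<close> the arc comes around from the greatest one.
\<close>

definition cyclic_floor :: "'a::linorder set \<Rightarrow> 'a \<Rightarrow> 'a" where
  "cyclic_floor S p = (if \<exists>q\<in>S. q \<le> p then Max {q \<in> S. q \<le> p} else Max S)"

lemma cyclic_pred_in:
  assumes "finite S" "S \<noteq> {}"
  shows "cyclic_pred S p \<in> S"
  using Max_in[of "{q \<in> S. q < p}"] assms by (auto simp: cyclic_pred_def)

lemma cyclic_floor_in:
  assumes "finite S" "S \<noteq> {}"
  shows "cyclic_floor S p \<in> S"
  using Max_in[of "{q \<in> S. q \<le> p}"] assms by (auto simp: cyclic_floor_def)

lemma cyclic_floor_self:
  assumes "finite S" "p \<in> S"
  shows "cyclic_floor S p = p"
  using assms by (auto simp: cyclic_floor_def intro!: Max_eqI)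

lemma cyclic_floor_notin:
  assumes "p \<notin> S"
  shows "cyclic_floor S p = cyclic_pred S p"
proof -
  have "q \<le> p \<longleftrightarrow> q < p" if "q \<in> S" for q using that assms by (auto simp: le_less)
  then show ?thesis by (simp add: cyclic_floor_def cyclic_pred_def cong: conj_cong bex_cong)
qed

lemma cyclic_pred_less:
  assumes "finite S" "q \<in> S" "q < p"
  shows "q \<le> cyclic_pred S p" "cyclic_pred S p < p"
proof -
  have "Max {q \<in> S. q < p} \<in> {q \<in> S. q < p}" using assms by (intro Max_in) auto
  then show "cyclic_pred S p < p" using assms by (auto simp: cyclic_pred_def)
  show "q \<le> cyclic_pred S p" using assms by (auto simp: cyclic_pred_def intro!: Max_ge)
qed

lemma cyclic_pred_min:
  assumes "finite S" "q \<in> S" "\<forall>q\<in>S. p \<le> q"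
  shows "q \<le> cyclic_pred S p"
  using assms by (auto simp: cyclic_pred_def dest!: leD)

text \<open>
  If the circle is cut at more points, the piece that ends at \<open>p\<close> belongs to the arc of \<open>S\<close> that ends
  at \<open>p\<close> or runs through it.
\<close>

lemma cyclic_floor_pred:
  assumes fin: "finite S'" and sub: "S \<subseteq> S'" and ne: "S \<noteq> {}"
  shows "cyclic_floor S (cyclic_pred S' p) = cyclic_pred S p"
proof -
  let ?m = "cyclic_pred S' p"
  have finS: "finite S" using fin sub by (rule finite_subset[rotated])
  consider (below) q where "q \<in> S" "q < p"
    | (only') q where "q \<in> S'" "q < p" "\<forall>q\<in>S. p \<le> q"
    | (none) "\<forall>q\<in>S'. p \<le> q" using sub by (meson linorder_not_le)
  then show ?thesis
  proof cases
    case below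
    have "q' \<le> ?m \<longleftrightarrow> q' < p" if "q' \<in> S" for q'
      using that cyclic_pred_less[OF fin, of _ p] below sub by (meson le_less_trans subsetD)
    then show ?thesis by (simp add: cyclic_floor_def cyclic_pred_def[of S] cong: conj_cong bex_cong)
  next
    case only'
    have "?m < p" using cyclic_pred_less[OF fin only'(1,2)] by simp
    then have "\<not> q' \<le> ?m" "\<not> q' < p" if "q' \<in> S" for q' using only'(3) that by fastforce+
    then show ?thesis by (auto simp: cyclic_floor_def cyclic_pred_def[of S])
  next
    case none
    have "q' \<le> ?m" "\<not> q' < p" if "q' \<in> S" for q'
      using cyclic_pred_min[OF fin _ none] that none sub by (auto simp: not_less)
    then have "{q \<in> S. q \<le> ?m} = S" "\<not> (\<exists>q\<in>S. q < p)" by auto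
    then show ?thesis using ne by (auto simp: cyclic_floor_def cyclic_pred_def[of S])
  qed
qed

lemma bij_betw_cyclic_pred:
  assumes fin: "finite S" and ne: "S \<noteq> {}"
  shows "bij_betw (cyclic_pred S) S S"
proof -
  have less: "cyclic_pred S p \<noteq> cyclic_pred S p'" if "p \<in> S" "p' \<in> S" "p < p'" for p p'
  proof (cases "\<exists>q\<in>S. q < p")
    case True
    then show ?thesis
      using cyclic_pred_less[OF fin, of _ p] cyclic_pred_less[OF fin that(1,3)] by force
  next
    case False
    then have "p' \<le> cyclic_pred S p" using cyclic_pred_min[OF fin that(2)] by (auto simp: not_less)
    then show ?thesis using cyclic_pred_less(2)[OF fin that(1,3)] by auto
  qed
  have inj: "inj_on (cyclic_pred S) S"
    unfolding inj_on_def by (metis less linorder_neqE)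
  then show ?thesis
    using endo_inj_surj[OF fin _ inj] cyclic_pred_in[OF fin ne] by (auto simp: bij_betw_def)
qed

text \<open>
  Number the points by their position when the circle is traversed starting from \<open>b\<close>.
\<close>

lemma cyclic_pred_order:
  fixes S :: "'a::linorder set"
  assumes fin: "finite S" and b: "b \<in> S"
  shows "\<exists>ord::'a \<Rightarrow> nat. \<forall>p\<in>S - {b}. cyclic_pred S p \<noteq> b \<longrightarrow> ord (cyclic_pred S p) < ord p"
proof -
  define ord where "ord p = (if b < p then card {q \<in> S. b < q \<and> q < p} else card S + card {q \<in> S. q < p})" for p
  have "ord (cyclic_pred S p) < ord p" if p: "p \<in> S" "p \<noteq> b" "cyclic_pred S p \<noteq> b" for p
  proof -
    let ?m = "cyclic_pred S p"
    have m: "?m \<in> S" using cyclic_pred_in[OF fin] b by blast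
    consider "b < p" | "p < b" "\<exists>q\<in>S. q < p" | "p < b" "\<forall>q\<in>S. p \<le> q"
      using p(2) by (meson linorder_neqE linorder_not_le)
    then show ?thesis
    proof cases
      case 1
      then have "b < ?m" "?m < p" using cyclic_pred_less[OF fin b 1] p(3) by auto
      moreover have "{q \<in> S. b < q \<and> q < ?m} \<subset> {q \<in> S. b < q \<and> q < p}"
        using \<open>b < ?m\<close> \<open>?m < p\<close> m by auto
      ultimately show ?thesis using 1 fin by (simp add: ord_def psubset_card_mono)
    next
      case 2
      then have "?m < p" using cyclic_pred_less(2)[OF fin] by blast
      moreover have "{q \<in> S. q < ?m} \<subset> {q \<in> S. q < p}" using \<open>?m < p\<close> m by auto
      ultimately show ?thesis using 2 fin by (auto simp: ord_def psubset_card_mono)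
    next
      case 3
      then have "b < ?m" using cyclic_pred_min[OF fin b 3(2)] p(3) by auto
      moreover have "card {q \<in> S. b < q \<and> q < ?m} < card S"
        using fin b by (intro psubset_card_mono) auto
      ultimately show ?thesis using 3 by (auto simp: ord_def)
    qed
  qed
  then show ?thesis by blast
qed

text \<open>
  The partial sums of \<open>\<epsilon>\<close> form a potential. It is consistent at the least point, whose predecessor is
  the greatest one, since the total is zero. Subtracting the minimum makes it nonnegative.
\<close>

lemma cyclic_height:
  fixes \<epsilon> :: "'a::linorder \<Rightarrow> int"
  assumes fin: "finite S" and sum0: "(\<Sum>p\<in>S. \<epsilon> p) = 0"
  shows "\<exists>h. \<forall>p\<in>S. h p \<ge> 0 \<and> h p = h (cyclic_pred S p) + \<epsilon> p"
proof -
  define e where "e p = (\<Sum>q | q \<in> S \<and> q \<le> p. \<epsilon> q)" for p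
  have step: "e p = e (cyclic_pred S p) + \<epsilon> p" if p: "p \<in> S" for p
  proof -
    have "{q \<in> S. q \<le> p} = insert p {q \<in> S. q < p}" using p by auto
    then have "e p = \<epsilon> p + (\<Sum>q | q \<in> S \<and> q < p. \<epsilon> q)" using fin by (simp add: e_def)
    also have "(\<Sum>q | q \<in> S \<and> q < p. \<epsilon> q) = e (cyclic_pred S p)"
    proof (cases "\<exists>q\<in>S. q < p")
      case True
      then obtain q0 where "q0 \<in> S" "q0 < p" by blast
      then have "{q \<in> S. q < p} = {q \<in> S. q \<le> cyclic_pred S p}"
        using cyclic_pred_less[OF fin, of _ p] by (auto intro: le_less_trans)
      then show ?thesis by (simp add: e_def)
    next
      case False
      then have sets: "{q \<in> S. q \<le> cyclic_pred S p} = S" "{q \<in> S. q < p} = {}"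
        using cyclic_pred_min[OF fin] by (auto simp: not_less)
      show ?thesis unfolding e_def sets using sum0 by simp
    qed
    finally show ?thesis by simp
  qed
  define c where "c = Min (insert 0 (e ` S))"
  have "c \<le> e p" if "p \<in> S" for p using that fin by (auto simp: c_def intro!: Min_le)
  then show ?thesis using step by (intro exI[of _ "\<lambda>p. e p - c"]) fastforce
qed

lemma cyclic_pred_nth:
  assumes fin: "finite S" and L: "L = sorted_list_of_set S" and j: "j < length L"
  shows "cyclic_pred S (L ! j) = L ! ((j + length L - 1) mod length L)"
proof -
  have set: "set L = S" and sorted: "sorted_wrt (<) L"
    using fin by (simp_all add: L)
  have nth_less: "L ! i < L ! i' \<longleftrightarrow> i < i'" if "i < length L" "i' < length L" for i i'
    using sorted_wrt_nth_less[OF sorted] that by (metis linorder_neqE_nat order_less_asym order_less_irrefl)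
  show ?thesis
  proof (cases j)
    case 0
    have "L ! 0 \<le> q" if "q \<in> S" for q
      using that nth_less[of _ 0] j 0 by (auto simp: set[symmetric] in_set_conv_nth not_less[symmetric])
    then have "cyclic_pred S (L ! j) = Max S" using 0 by (auto simp: cyclic_pred_def not_less[symmetric])
    also have "\<dots> = L ! (length L - 1)"
    proof (rule Max_eqI[OF fin])
      fix y assume "y \<in> S"
      then obtain i where "i < length L" "y = L ! i" by (auto simp: set[symmetric] in_set_conv_nth)
      then show "y \<le> L ! (length L - 1)" using nth_less[of "length L - 1" i] j by (auto simp: not_less[symmetric])
    qed (use j set in \<open>auto simp flip: set\<close>)
    finally show ?thesis using 0 j by simp
  next
    case (Suc i)
    have "Max {q \<in> S. q < L ! j} = L ! i"
    proof (rule Max_eqI)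
      fix y assume "y \<in> {q \<in> S. q < L ! j}"
      then obtain i' where i': "i' < length L" "y = L ! i'" "L ! i' < L ! j"
        by (auto simp: set[symmetric] in_set_conv_nth)
      then have "i' < j" using nth_less j by blast
      then show "y \<le> L ! i" using nth_less[of i i'] i' j Suc by (auto simp: not_less[symmetric])
    qed (use j Suc nth_less[of i j] fin in \<open>auto simp flip: set\<close>)
    moreover have "\<exists>q\<in>S. q < L ! j"
      using j Suc nth_less[of i j] by (intro bexI[of _ "L ! i"]) (auto simp flip: set)
    ultimately show ?thesis using Suc j by (simp add: cyclic_pred_def)
  qed
qed

section \<open>Vertices and strands of a diagram\<close>

definition vertex_params :: "diagram \<Rightarrow> plane set \<Rightarrow> real set" where
  "vertex_params D F = preimages (curve D) (vertices D F)"

abbreviation at_flat :: "diagram \<Rightarrow> real \<Rightarrow> bool" where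
  "at_flat D p \<equiv> curve D p \<in> flat_crossings D"

text \<open>
  The other parameter at which the curve passes through the same crossing. It does not depend on the
  chosen fake vertices. Away from the flat crossings the default \<open>p\<close> keeps the map an
  involution, and the coefficient that is used with it is zero there.
\<close>

definition other_strand :: "diagram \<Rightarrow> real \<Rightarrow> real" where
  "other_strand D p =
    (if at_flat D p then THE q. q \<in> preimages (curve D) {curve D p} \<and> q \<noteq> p else p)"

definition is_strand2 :: "diagram \<Rightarrow> real \<Rightarrow> bool" where
  "is_strand2 D p \<longleftrightarrow>
    orient (velocity (curve D) (other_strand D p)) (velocity (curve D) p) > 0"

locale flat_diagram =
  fixes D :: diagram
  assumes diagram: "flat_virtual_knot_diagram D"
begin

lemma flat_crossings_multiple: "flat_crossings D \<subseteq> multiple_points (curve D)"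
  and multiple_points_finite: "finite (multiple_points (curve D))"
  and card_preimages: "x \<in> multiple_points (curve D) \<Longrightarrow> card (preimages (curve D) {x}) = 2"
  and transversal: "\<forall>x\<in>multiple_points (curve D). \<forall>p\<in>preimages (curve D) {x}.
    \<forall>q\<in>preimages (curve D) {x}. p \<noteq> q \<longrightarrow> orient (velocity (curve D) p) (velocity (curve D) q) \<noteq> 0"
  using diagram unfolding flat_virtual_knot_diagram_def generic_immersion_def by simp_all

lemma other_strand_flat:
  assumes p: "p \<in> {0..<1}" and flat: "at_flat D p"
  shows "other_strand D p \<in> {0..<1}" "other_strand D p \<noteq> p"
    "curve D (other_strand D p) = curve D p"
    "\<And>q. q \<in> {0..<1} \<Longrightarrow> curve D q = curve D p \<Longrightarrow> q \<noteq> p \<Longrightarrow> q = other_strand D p"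
proof -
  let ?P = "preimages (curve D) {curve D p}"
  have pP: "p \<in> ?P" using p by (simp add: preimages_def)
  have "card ?P = 2" by (rule card_preimages[OF subsetD[OF flat_crossings_multiple flat]])
  then obtain a c where ac: "?P = {a, c}" "a \<noteq> c" unfolding card_2_iff by blast
  define q0 where "q0 = (if p = a then c else a)"
  have q0: "?P = {p, q0}" "q0 \<noteq> p" using pP ac(2) unfolding ac(1) q0_def by auto
  have "(THE q. q \<in> ?P \<and> q \<noteq> p) = q0"
    unfolding q0(1) using q0(2) by (intro the_equality) auto
  then have eq: "other_strand D p = q0" using flat by (simp add: other_strand_def)
  have mem: "q0 \<in> ?P" using q0(1) by simp
  then show "other_strand D p \<in> {0..<1}" "other_strand D p \<noteq> p"
    "curve D (other_strand D p) = curve D p" using q0(2) by (simp_all add: eq preimages_def)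
  show "q = other_strand D p" if "q \<in> {0..<1}" "curve D q = curve D p" "q \<noteq> p" for q
  proof -
    have "q \<in> ?P" using that by (simp add: preimages_def)
    then show ?thesis unfolding q0(1) eq using that(3) by simp
  qed
qed

lemma other_strand_involution:
  assumes "p \<in> {0..<1}" "at_flat D p"
  shows "other_strand D (other_strand D p) = p"
proof -
  note q = other_strand_flat(1-3)[OF assms]
  have "at_flat D (other_strand D p)" using q(3) assms(2) by simp
  from other_strand_flat(4)[OF q(1) this assms(1) q(3)[symmetric] q(2)[symmetric]]
  show ?thesis by (rule sym)
qed

lemma orient_swap: "orient u v = - orient v u"
  by (simp add: orient_def det_2)

lemma is_strand2_other:
  assumes p: "p \<in> {0..<1}" and flat: "at_flat D p"
  shows "is_strand2 D (other_strand D p) \<longleftrightarrow> \<not> is_strand2 D p"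
proof -
  define q where "q = other_strand D p"
  note o = other_strand_flat(1-3)[OF p flat, folded q_def]
  have m: "curve D p \<in> multiple_points (curve D)" using flat flat_crossings_multiple by blast
  have "p \<in> preimages (curve D) {curve D p}" "q \<in> preimages (curve D) {curve D p}"
    using p o by (simp_all add: preimages_def)
  then have "orient (velocity (curve D) q) (velocity (curve D) p) \<noteq> 0"
    using transversal m o(2) by blast
  moreover have "orient (velocity (curve D) p) (velocity (curve D) q)
      = - orient (velocity (curve D) q) (velocity (curve D) p)" by (rule orient_swap)
  moreover have qq: "other_strand D q = p"
    unfolding q_def by (rule other_strand_involution[OF p flat])
  ultimately show ?thesis
    unfolding is_strand2_def q_def[symmetric] qq by linarith
qed

lemma preimages_multiple_finite: "finite (preimages (curve D) (flat_crossings D))"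
proof -
  have "preimages (curve D) (flat_crossings D) = (\<Union>x\<in>flat_crossings D. preimages (curve D) {x})"
    by (auto simp: preimages_def)
  moreover have "finite (preimages (curve D) {x})" if "x \<in> flat_crossings D" for x
    using card_preimages[OF subsetD[OF flat_crossings_multiple that]] by (intro card_ge_0_finite) simp
  ultimately show ?thesis
    using finite_subset[OF flat_crossings_multiple multiple_points_finite] by simp
qed

lemma vertex_params_finite:
  assumes "is_fake_vertex_set D F"
  shows "finite (vertex_params D F)"
proof -
  have "inj_on (curve D) (preimages (curve D) F)"
  proof (rule inj_onI, rule ccontr)
    fix x y assume xy: "x \<in> preimages (curve D) F" "y \<in> preimages (curve D) F"
      "curve D x = curve D y" "x \<noteq> y"
    have "x \<in> preimages (curve D) {curve D x}" "y \<in> preimages (curve D) {curve D x}"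
      using xy(1,2) xy(3)[symmetric] by (simp_all add: preimages_def)
    then have "curve D x \<in> multiple_points (curve D)"
      unfolding multiple_points_def using xy(4) by blast
    moreover have "curve D x \<in> F" using xy(1) by (simp add: preimages_def)
    ultimately show False using assms unfolding is_fake_vertex_set_def by blast
  qed
  moreover have "finite (curve D ` preimages (curve D) F)"
  proof (rule finite_subset)
    show "curve D ` preimages (curve D) F \<subseteq> F" by (auto simp: preimages_def)
    show "finite F" using assms by (simp add: is_fake_vertex_set_def)
  qed
  ultimately have "finite (preimages (curve D) F)"
    by (rule finite_imageD[rotated])
  moreover have "vertex_params D F = preimages (curve D) (flat_crossings D) \<union> preimages (curve D) F"
    by (auto simp: vertex_params_def vertices_def preimages_def)
  ultimately show ?thesis using preimages_multiple_finite by simp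
qed

lemma curve_frac: "curve D (frac x) = curve D x"
proof -
  have per: "curve D (x + 1) = curve D x" for x
    using diagram by (simp add: flat_virtual_knot_diagram_def generic_immersion_def circle_immersion_def)
  have pn: "curve D (x + real m) = curve D x" for x m
  proof (induction m)
    case (Suc m)
    then show ?case using per[of "x + real m"] by (simp add: add_ac)
  qed simp
  have "curve D (x + of_int k) = curve D x" for x k
  proof (cases k)
    case (nonneg m)
    then show ?thesis using pn by simp
  next
    case (neg m)
    then have "x + of_int k + real (Suc m) = x" by simp
    then show ?thesis using pn[of "x + of_int k" "Suc m"] by (simp only:)
  qed
  from this[of "frac x" "\<lfloor>x\<rfloor>"] show ?thesis by (simp add: frac_def)
qed

lemma vertex_params_nonempty:
  assumes F: "is_fake_vertex_set D F" and ne: "vertices D F \<noteq> {}"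
  shows "vertex_params D F \<noteq> {}"
proof -
  obtain v where v: "v \<in> vertices D F" using ne by blast
  have "multiple_points (curve D) \<subseteq> range (curve D)"
    by (auto simp: multiple_points_def preimages_def)
  then have "v \<in> range (curve D)"
    using v F flat_crossings_multiple unfolding vertices_def is_fake_vertex_set_def by blast
  then obtain x where "v = curve D (frac x)" by (auto simp: curve_frac)
  then have "frac x \<in> vertex_params D F"
    using v by (auto simp: vertex_params_def preimages_def frac_lt_1)
  then show ?thesis by blast
qed

lemma vertex_params_range: "p \<in> vertex_params D F \<Longrightarrow> p \<in> {0..<1}"
  by (simp add: vertex_params_def preimages_def)

lemma other_strand_in:
  assumes "p \<in> vertex_params D F"
  shows "other_strand D p \<in> vertex_params D F"
proof (cases "at_flat D p")
  case True
  then show ?thesis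
    using other_strand_flat(1,3)[OF vertex_params_range[OF assms] True] assms
    by (simp add: vertex_params_def preimages_def)
qed (use assms in \<open>simp add: other_strand_def\<close>)

text \<open>
  Modulo \<open>t\<close>, passing the point \<open>p\<close> multiplies the color by \<open>s\<close> to this power.
\<close>

definition exponent :: "real \<Rightarrow> int" where
  "exponent p = (if at_flat D p then if is_strand2 D p then 1 else -1 else 0)"

text \<open>
  At each flat crossing exactly one of the two strands is strand 2, so the exponents cancel in pairs.
\<close>

lemma sum_exponent:
  assumes F: "is_fake_vertex_set D F"
  shows "(\<Sum>p\<in>vertex_params D F. exponent p) = 0"
proof -
  let ?P = "vertex_params D F"
  have neg: "exponent (other_strand D p) = - exponent p" if p: "p \<in> ?P" for p
  proof (cases "at_flat D p")
    case True
    then show ?thesis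
      using other_strand_flat(3)[OF vertex_params_range[OF p] True]
        is_strand2_other[OF vertex_params_range[OF p] True] by (auto simp: exponent_def)
  qed (simp add: exponent_def other_strand_def)
  have inv: "other_strand D (other_strand D p) = p" if p: "p \<in> ?P" for p
  proof (cases "at_flat D p")
    case True
    then show ?thesis using other_strand_involution vertex_params_range[OF p] by blast
  qed (simp add: other_strand_def)
  have "bij_betw (other_strand D) ?P ?P"
    by (rule bij_betwI[where g="other_strand D"]) (auto simp: inv other_strand_in)
  then have "(\<Sum>p\<in>?P. exponent p) = (\<Sum>p\<in>?P. exponent (other_strand D p))"
    by (rule sum.reindex_bij_betw[symmetric])
  also have "\<dots> = - (\<Sum>p\<in>?P. exponent p)"
    by (simp add: neg sum_negf)
  finally show ?thesis by simp
qed

end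

section \<open>The coloring system of a diagram\<close>

definition coeff_prev :: "nat \<Rightarrow> diagram \<Rightarrow> real \<Rightarrow> free_alg set" where
  "coeff_prev n D p = \<ominus>\<^bsub>S_ring n\<^esub>
    (if at_flat D p then
       if is_strand2 D p then s_elt n
       else sinv_elt n \<otimes>\<^bsub>S_ring n\<^esub> (\<one>\<^bsub>S_ring n\<^esub> \<ominus>\<^bsub>S_ring n\<^esub> t_elt n [^]\<^bsub>S_ring n\<^esub> (2::nat))
     else \<one>\<^bsub>S_ring n\<^esub>)"

definition coeff_cross :: "nat \<Rightarrow> diagram \<Rightarrow> real \<Rightarrow> free_alg set" where
  "coeff_cross n D p =
    (if at_flat D p then
       if is_strand2 D p then \<ominus>\<^bsub>S_ring n\<^esub> t_elt n
       else sinv_elt n \<otimes>\<^bsub>S_ring n\<^esub> t_elt n \<otimes>\<^bsub>S_ring n\<^esub> s_elt n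
     else \<zero>\<^bsub>S_ring n\<^esub>)"

context flat_diagram
begin

text \<open>
  The weight of a point is \<open>s\<close> to its height. On strand 1 the equation holds only modulo \<open>t\<close>, because
  of the summand with \<open>t\<^sup>2\<close>.
\<close>

lemma coloring_system:
  assumes F: "is_fake_vertex_set D F" and ne: "vertices D F \<noteq> {}"
  shows "\<exists>w. cyclic_system (S_ring n) (t_elt n) (n + 1) (vertex_params D F)
    (cyclic_pred (vertex_params D F)) (other_strand D) (coeff_prev n D) (coeff_cross n D) w"
proof -
  interpret R: normal_nilpotent "S_ring n" "t_elt n" "n + 1" by (rule S_ring_normal_nilpotent)
  let ?R = "S_ring n" and ?S = "vertex_params D F"
  let ?s = "s_elt n" and ?s' = "sinv_elt n" and ?t = "t_elt n"
  have fin: "finite ?S" and S_ne: "?S \<noteq> {}"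
    using vertex_params_finite[OF F] vertex_params_nonempty[OF F ne] by auto
  obtain h :: "real \<Rightarrow> int" where h0: "\<And>p. p \<in> ?S \<Longrightarrow> h p \<ge> 0"
    and h: "\<And>p. p \<in> ?S \<Longrightarrow> h p = h (cyclic_pred ?S p) + exponent p"
    using cyclic_height[OF fin sum_exponent[OF F]] by blast
  define w where "w p = ?s [^]\<^bsub>?R\<^esub> nat (h p)" for p
  have s_unit: "?s \<in> Units ?R" using s_elt_inverse[of n] by (auto simp: Units_def)
  have wc: "w p \<in> carrier ?R" for p by (simp add: w_def)
  have "?s [^]\<^bsub>?R\<^esub> (m::nat) \<in> Units ?R" for m
    using s_unit by (induction m) auto
  then have w_unit: "w p \<in> Units ?R" for p by (simp add: w_def)
  have t1: "?t \<in> R.T 1" by (auto simp: R.T_def intro!: exI[of _ "\<one>\<^bsub>?R\<^esub>"])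
  have s_step: "?s [^]\<^bsub>?R\<^esub> Suc m = ?s \<otimes>\<^bsub>?R\<^esub> ?s [^]\<^bsub>?R\<^esub> m" for m
    by (rule R.nat_pow_Suc2) simp
  show ?thesis
  proof (intro exI[of _ w], unfold_locales)
    show "finite ?S" by (rule fin)
    show "bij_betw (cyclic_pred ?S) ?S ?S" by (rule bij_betw_cyclic_pred[OF fin S_ne])
    show "\<exists>ord::real \<Rightarrow> nat. \<forall>p\<in>?S - {b}. cyclic_pred ?S p \<noteq> b \<longrightarrow> ord (cyclic_pred ?S p) < ord p"
      if "b \<in> ?S" for b by (rule cyclic_pred_order[OF fin that])
    fix p assume p: "p \<in> ?S"
    show "other_strand D p \<in> ?S" by (rule other_strand_in[OF p])
    show "coeff_prev n D p \<in> carrier ?R" by (auto simp: coeff_prev_def)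
    show "coeff_cross n D p \<in> R.T 1"
      unfolding coeff_cross_def using R.T_neg[OF t1] R.T_mult_right[OF R.T_mult_left[OF _ t1]] by auto
    show "w p \<in> Units ?R" by (rule w_unit)
    let ?w' = "w (cyclic_pred ?S p)"
    have h': "h (cyclic_pred ?S p) \<ge> 0" using h0 cyclic_pred_in[OF fin S_ne] by blast
    consider (fake) "\<not> at_flat D p" | (strand2) "at_flat D p" "is_strand2 D p"
      | (strand1) "at_flat D p" "\<not> is_strand2 D p" by blast
    then show "coeff_prev n D p \<otimes>\<^bsub>?R\<^esub> ?w' \<oplus>\<^bsub>?R\<^esub> w p \<in> R.T 1"
    proof cases
      case fake
      then have "w p = ?w'" using h[OF p] by (simp add: w_def exponent_def)
      then have "coeff_prev n D p \<otimes>\<^bsub>?R\<^esub> ?w' \<oplus>\<^bsub>?R\<^esub> w p = \<zero>\<^bsub>?R\<^esub>"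
        using fake wc by (simp add: coeff_prev_def R.l_minus R.l_neg)
      then show ?thesis by simp
    next
      case strand2
      then have "nat (h p) = Suc (nat (h (cyclic_pred ?S p)))"
        using h[OF p] h' by (simp add: exponent_def)
      then have "w p = ?s \<otimes>\<^bsub>?R\<^esub> ?w'" by (simp only: w_def s_step)
      then have "coeff_prev n D p \<otimes>\<^bsub>?R\<^esub> ?w' \<oplus>\<^bsub>?R\<^esub> w p = \<zero>\<^bsub>?R\<^esub>"
        using strand2 wc by (simp add: coeff_prev_def R.l_minus R.l_neg)
      then show ?thesis by simp
    next
      case strand1
      then have "nat (h (cyclic_pred ?S p)) = Suc (nat (h p))"
        using h[OF p] h0[OF p] by (simp add: exponent_def)
      then have "?w' = ?s \<otimes>\<^bsub>?R\<^esub> w p" by (simp only: w_def s_step)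
      then have w: "w p = ?s' \<otimes>\<^bsub>?R\<^esub> ?w'"
        using wc s_elt_inverse(2)[of n] by (simp add: R.m_assoc[symmetric])
      have expand: "\<ominus>\<^bsub>?R\<^esub> (a \<otimes>\<^bsub>?R\<^esub> (\<one>\<^bsub>?R\<^esub> \<ominus>\<^bsub>?R\<^esub> c)) \<otimes>\<^bsub>?R\<^esub> v \<oplus>\<^bsub>?R\<^esub> a \<otimes>\<^bsub>?R\<^esub> v
          = a \<otimes>\<^bsub>?R\<^esub> c \<otimes>\<^bsub>?R\<^esub> v"
        if "a \<in> carrier ?R" "c \<in> carrier ?R" "v \<in> carrier ?R" for a c v
        using that by algebra
      have "coeff_prev n D p \<otimes>\<^bsub>?R\<^esub> ?w' \<oplus>\<^bsub>?R\<^esub> w p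
          = ?s' \<otimes>\<^bsub>?R\<^esub> ?t [^]\<^bsub>?R\<^esub> (2::nat) \<otimes>\<^bsub>?R\<^esub> ?w'"
        unfolding w using strand1 wc by (simp add: coeff_prev_def expand)
      moreover have "?t [^]\<^bsub>?R\<^esub> (2::nat) \<in> R.T 1"
        using R.T_mult_right[OF t1, of ?t] by (simp add: numeral_2_eq_2)
      ultimately show ?thesis using wc R.T_mult_left R.T_mult_right by simp
    qed
  qed
qed

end

section \<open>Arc labels\<close>

context flat_diagram
begin

lemma num_arcs_eq: "num_arcs D F = card (vertex_params D F)"
  by (simp add: num_arcs_def vertex_params_def)

lemma arc_start_bij:
  assumes F: "is_fake_vertex_set D F"
  shows "bij_betw (arc_start D F r) {1..num_arcs D F} (vertex_params D F)"
proof -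
  let ?S = "vertex_params D F" and ?k = "num_arcs D F"
  let ?L = "rotate r (sorted_list_of_set ?S)"
  have len: "length ?L = ?k" by (simp add: num_arcs_eq)
  have "bij_betw (\<lambda>i. ?L ! i) {..<?k} ?S"
    using vertex_params_finite[OF F] len by (intro bij_betw_nth) auto
  moreover have "bij_betw (\<lambda>i. i - 1) {1..?k} {..<?k}"
    by (rule bij_betwI[where g = Suc]) auto
  ultimately have "bij_betw ((\<lambda>i. ?L ! i) \<circ> (\<lambda>i. i - 1)) {1..?k} ?S"
    by (rule bij_betw_trans[rotated])
  then show ?thesis
    by (simp add: arc_start_def vertex_params_def comp_def cong: bij_betw_cong)
qed

lemma arc_start_in:
  assumes "is_fake_vertex_set D F" "i \<in> {1..num_arcs D F}"
  shows "arc_start D F r i \<in> vertex_params D F"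
  using arc_start_bij[OF assms(1)] assms(2) by (rule bij_betwE[THEN bspec])

lemma arc_start_eq_iff:
  assumes "is_fake_vertex_set D F" "i \<in> {1..num_arcs D F}" "l \<in> {1..num_arcs D F}"
  shows "arc_start D F r i = arc_start D F r l \<longleftrightarrow> i = l"
  using bij_betw_imp_inj_on[OF arc_start_bij[OF assms(1)]] assms(2,3) by (rule inj_on_eq_iff)

lemma prev_arc_in: "i \<in> {1..num_arcs D F} \<Longrightarrow> prev_arc D F i \<in> {1..num_arcs D F}"
  by (auto simp: prev_arc_def)

lemma arc_start_prev:
  assumes F: "is_fake_vertex_set D F" and i: "i \<in> {1..num_arcs D F}"
  shows "arc_start D F r (prev_arc D F i) = cyclic_pred (vertex_params D F) (arc_start D F r i)"
proof -
  let ?S = "vertex_params D F"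
  define L where "L = sorted_list_of_set ?S"
  define k where "k = num_arcs D F"
  have len: "length L = k" by (simp add: L_def k_def num_arcs_eq)
  have k: "k > 0" using i by (simp add: k_def)
  have start: "arc_start D F r l = L ! ((r + (l - 1)) mod k)" if "l \<in> {1..k}" for l
    using that len nth_rotate[of "l - 1" L r] by (auto simp: arc_start_def vertex_params_def L_def)
  have "cyclic_pred ?S (arc_start D F r i) = L ! (((r + (i - 1)) mod k + k - 1) mod k)"
    using cyclic_pred_nth[OF vertex_params_finite[OF F] L_def, of "(r + (i - 1)) mod k"] start[of i] i k len
    by (simp add: k_def)
  also have "((r + (i - 1)) mod k + k - 1) mod k = ((r + (i - 1)) mod k + (k - 1)) mod k"
    using k by simp
  also have "\<dots> = (r + (i - 1) + (k - 1)) mod k" by (rule mod_add_left_eq)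
  also have "\<dots> = (r + (prev_arc D F i - 1)) mod k"
  proof (cases "i = 1")
    case True
    then show ?thesis by (simp add: prev_arc_def k_def)
  next
    case False
    then have shift: "r + (i - 1) + (k - 1) = r + (prev_arc D F i - 1) + k"
      using i k by (auto simp: prev_arc_def)
    show ?thesis unfolding shift by (rule mod_add_self2)
  qed
  finally show ?thesis using start prev_arc_in[OF i] by (simp add: k_def)
qed

lemma opposite_arc:
  assumes F: "is_fake_vertex_set D F" and i: "i \<in> {1..num_arcs D F}"
    and flat: "at_flat D (arc_start D F r i)"
  shows "opposite_arc D F r i \<in> {1..num_arcs D F}"
    and "arc_start D F r (opposite_arc D F r i) = other_strand D (arc_start D F r i)"
proof -
  let ?g = "arc_start D F r" and ?S = "vertex_params D F" and ?k = "num_arcs D F"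
  have gi: "?g i \<in> ?S" by (rule arc_start_in[OF F i])
  note other = other_strand_flat[OF vertex_params_range[OF gi] flat]
  have "other_strand D (?g i) \<in> ?g ` {1..?k}"
    using other_strand_in[OF gi] bij_betw_imp_surj_on[OF arc_start_bij[OF F]] by simp
  then obtain l where l: "l \<in> {1..?k}" "?g l = other_strand D (?g i)" by force
  have "opposite_arc D F r i = l"
    unfolding opposite_arc_def
  proof (rule the_equality)
    have "l \<noteq> i" using l(2) other(2) by metis
    then show "l \<in> {1..?k} \<and> l \<noteq> i \<and> curve D (?g l) = curve D (?g i)"
      using l other(3) by simp
    fix l' assume l': "l' \<in> {1..?k} \<and> l' \<noteq> i \<and> curve D (?g l') = curve D (?g i)"
    then have "?g l' \<noteq> ?g i" using arc_start_eq_iff[OF F _ i] by blast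
    then have "?g l' = ?g l"
      using l' l(2) other(4)[OF vertex_params_range[OF arc_start_in[OF F]]] by simp
    then show "l' = l" using arc_start_eq_iff[OF F _ l(1)] l' by blast
  qed
  then show "opposite_arc D F r i \<in> {1..?k}" "?g (opposite_arc D F r i) = other_strand D (?g i)"
    using l by simp_all
qed

text \<open>
  Translated from labels to parameters, the entries have coefficients that do not mention the
  vertex set; only \<open>cyclic_pred\<close> does.
\<close>

lemma coloring_matrix_entry:
  fixes n r i l F
  defines "R \<equiv> S_ring n" and "S \<equiv> vertex_params D F" and "g \<equiv> arc_start D F r"
  assumes F: "is_fake_vertex_set D F" and i: "i \<in> {1..num_arcs D F}" and l: "l \<in> {1..num_arcs D F}"
  shows "coloring_matrix n D F r i l =
    (if g l = g i then \<one>\<^bsub>R\<^esub> else \<zero>\<^bsub>R\<^esub>)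
    \<oplus>\<^bsub>R\<^esub> coeff_prev n D (g i) \<otimes>\<^bsub>R\<^esub> (if g l = cyclic_pred S (g i) then \<one>\<^bsub>R\<^esub> else \<zero>\<^bsub>R\<^esub>)
    \<oplus>\<^bsub>R\<^esub> coeff_cross n D (g i) \<otimes>\<^bsub>R\<^esub>
      (if g l = cyclic_pred S (other_strand D (g i)) then \<one>\<^bsub>R\<^esub> else \<zero>\<^bsub>R\<^esub>)"
proof -
  interpret R: ring R unfolding R_def by (rule ring_S_ring)
  have closed: "s_elt n \<in> carrier R" "sinv_elt n \<in> carrier R" "t_elt n \<in> carrier R"
    by (simp_all add: R_def)
  define e where "e p = (if g l = p then \<one>\<^bsub>R\<^esub> else \<zero>\<^bsub>R\<^esub>)" for p
  have ec: "e p \<in> carrier R" for p by (simp add: e_def)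
  have e_arc: "(if l = m then \<one>\<^bsub>R\<^esub> else \<zero>\<^bsub>R\<^esub>) = e (g m)" if "m \<in> {1..num_arcs D F}" for m
    using arc_start_eq_iff[OF F l that] by (simp add: e_def g_def)
  have prev: "e (g (prev_arc D F m)) = e (cyclic_pred S (g m))" if "m \<in> {1..num_arcs D F}" for m
    using arc_start_prev[OF F that] by (simp add: g_def S_def)
  note ei = e_arc[OF i] and eh = e_arc[OF prev_arc_in[OF i], unfolded prev[OF i]]
  show ?thesis
  proof (cases "at_flat D (g i)")
    case False
    then have "coloring_matrix n D F r i l = e (g i) \<ominus>\<^bsub>R\<^esub> e (cyclic_pred S (g i))"
      unfolding coloring_matrix_def Let_def R_def[symmetric] ei eh by (simp add: g_def)
    then show ?thesis
      using False ec unfolding e_def[symmetric]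
      by (simp add: coeff_prev_def coeff_cross_def R_def[symmetric] R.l_minus R.minus_eq)
  next
    case True
    note opp = opposite_arc[OF F i True[unfolded g_def], folded g_def]
    have strand: "on_strand2 D F r i \<longleftrightarrow> is_strand2 D (g i)"
      using opp(2) by (simp add: on_strand2_def is_strand2_def g_def)
    have ej: "(if l = prev_arc D F (opposite_arc D F r i) then \<one>\<^bsub>R\<^esub> else \<zero>\<^bsub>R\<^esub>)
        = e (cyclic_pred S (other_strand D (g i)))"
      using e_arc[OF prev_arc_in[OF opp(1)]] prev[OF opp(1)] opp(2) by simp
    have "coloring_matrix n D F r i l =
      (if is_strand2 D (g i)
       then e (g i) \<ominus>\<^bsub>R\<^esub> s_elt n \<otimes>\<^bsub>R\<^esub> e (cyclic_pred S (g i))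
          \<ominus>\<^bsub>R\<^esub> t_elt n \<otimes>\<^bsub>R\<^esub> e (cyclic_pred S (other_strand D (g i)))
       else e (g i) \<ominus>\<^bsub>R\<^esub> sinv_elt n \<otimes>\<^bsub>R\<^esub> (\<one>\<^bsub>R\<^esub> \<ominus>\<^bsub>R\<^esub> t_elt n [^]\<^bsub>R\<^esub> (2::nat)) \<otimes>\<^bsub>R\<^esub> e (cyclic_pred S (g i))
          \<oplus>\<^bsub>R\<^esub> sinv_elt n \<otimes>\<^bsub>R\<^esub> t_elt n \<otimes>\<^bsub>R\<^esub> s_elt n \<otimes>\<^bsub>R\<^esub> e (cyclic_pred S (other_strand D (g i))))"
      unfolding coloring_matrix_def Let_def R_def[symmetric] ei eh ej strand
      using True by (simp add: g_def)
    then show ?thesis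
      using True ec closed unfolding e_def[symmetric]
      by (simp add: coeff_prev_def coeff_cross_def R_def[symmetric] R.l_minus R.minus_eq)
  qed
qed

section \<open>Refining the vertex set\<close>

text \<open>
  The null vector on the coarser vertex set is extended to the finer one by giving every piece the
  entry of the arc that contains it. The new rows belong to fake vertices inside an arc, where the
  two entries that occur are equal.
\<close>

lemma quasidet_null_vector:
  fixes n r F F' w'
  defines "R \<equiv> S_ring n"
  assumes F: "is_fake_vertex_set D F" "vertices D F \<noteq> {}"
    and F': "is_fake_vertex_set D F'" and sub: "F \<subseteq> F'"
    and system: "cyclic_system R (t_elt n) (n + 1) (vertex_params D F')
      (cyclic_pred (vertex_params D F')) (other_strand D) (coeff_prev n D) (coeff_cross n D) w'"
  defines "S' \<equiv> vertex_params D F'" and "k \<equiv> num_arcs D F" and "A \<equiv> coloring_matrix n D F r"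
  defines "M' \<equiv> cyclic_system.M R (cyclic_pred S') (other_strand D) (coeff_prev n D) (coeff_cross n D)"
  obtains b x where "quasidet_defined R k A k k"
    and "b \<in> S'" and "\<And>q. q \<in> S' \<Longrightarrow> x q \<in> carrier R" and "x b = \<one>\<^bsub>R\<^esub>"
    and "\<And>p. p \<in> S' - {b} \<Longrightarrow> (\<Oplus>\<^bsub>R\<^esub>q\<in>S'. M' p q \<otimes>\<^bsub>R\<^esub> x q) = \<zero>\<^bsub>R\<^esub>"
    and "(\<Oplus>\<^bsub>R\<^esub>q\<in>S'. M' b q \<otimes>\<^bsub>R\<^esub> x q) = quasidet R k A k k"
proof -
  define S where "S = vertex_params D F"
  define g where "g = arc_start D F r"
  obtain w where "cyclic_system R (t_elt n) (n + 1) S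
      (cyclic_pred S) (other_strand D) (coeff_prev n D) (coeff_cross n D) w"
    using coloring_system[OF F] unfolding R_def S_def by blast
  then interpret C: cyclic_system R "t_elt n" "n + 1" S "cyclic_pred S" "other_strand D"
    "coeff_prev n D" "coeff_cross n D" w .
  interpret C': cyclic_system R "t_elt n" "n + 1" S' "cyclic_pred S'" "other_strand D"
    "coeff_prev n D" "coeff_cross n D" w' using system unfolding S'_def .
  have M': "M' = C'.M" by (simp add: M'_def)
  have S_ne: "S \<noteq> {}" using vertex_params_nonempty[OF F] by (simp add: S_def)
  have S_sub: "S \<subseteq> S'" using sub by (auto simp: S_def S'_def vertex_params_def vertices_def preimages_def)
  have k: "k > 0" using S_ne C.fin by (simp add: k_def num_arcs_eq S_def card_gt_0_iff)
  have bij: "bij_betw g {1..k} S"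
    unfolding g_def k_def S_def by (rule arc_start_bij[OF F(1)])
  have gS: "g i \<in> S" if "i \<in> {1..k}" for i using bij that by (rule bij_betwE[THEN bspec])
  have A: "A i l = C.M (g i) (g l)" if "i \<in> {1..k}" "l \<in> {1..k}" for i l
    unfolding A_def C.M_def using coloring_matrix_entry[OF F(1), of i l n r] that
    by (simp add: R_def S_def g_def k_def)
  have Ac: "A i l \<in> carrier R" if "i \<in> {1..k}" "l \<in> {1..k}" for i l
    using that by (simp add: A gS C.M_closed)
  let ?I = "{1..k} - {k}"
  have "A i l \<ominus>\<^bsub>R\<^esub> C.delta i l \<in> C.T 1" if "i \<in> ?I" "l \<in> ?I" "i \<le> l" for i l
  proof -
    have il: "i \<in> {1..k}" "l \<in> {1..k}" using that by simp_all
    have ne: "l \<noteq> prev_arc D F i" using that by (auto simp: prev_arc_def k_def)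
    have "g l \<noteq> g (prev_arc D F i)"
      using arc_start_eq_iff[OF F(1) il(2)[unfolded k_def] prev_arc_in[OF il(1)[unfolded k_def]]] ne
      by (simp add: g_def)
    then have "g l \<noteq> cyclic_pred S (g i)"
      unfolding g_def S_def arc_start_prev[OF F(1) il(1)[unfolded k_def]] .
    from C.M_off_pred[OF gS[OF il(1)] gS[OF il(2)] this]
    have "A i l \<ominus>\<^bsub>R\<^esub> C.delta (g i) (g l) \<in> C.T 1" unfolding A[OF il] .
    moreover have "g i = g l \<longleftrightarrow> i = l"
      unfolding g_def using il by (intro arc_start_eq_iff[OF F(1)]) (simp_all add: k_def)
    ultimately show ?thesis by (simp only:)
  qed
  then have "C.unitriangular (\<lambda>i. i) ?I A"
    using Ac by (auto simp: C.unitriangular_def)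
  then have ex: "\<exists>B. is_mat_inverse R ?I ?I A B"
    by (intro C.unitriangular_invertible) auto
  then have inverse: "is_mat_inverse R ?I ?I A (mat_inverse R ?I ?I A)"
    unfolding mat_inverse_def by (rule someI_ex)
  have defined: "quasidet_defined R k A k k"
    using ex k by (auto simp: quasidet_defined_def)
  have kk: "k \<in> {1..k}" using k by simp
  have quasi: "quasidet R k A k k = A k k \<ominus>\<^bsub>R\<^esub>
      (\<Oplus>\<^bsub>R\<^esub>q\<in>?I. \<Oplus>\<^bsub>R\<^esub>p\<in>?I. A k q \<otimes>\<^bsub>R\<^esub> mat_inverse R ?I ?I A q p \<otimes>\<^bsub>R\<^esub> A p k)"
  proof (cases "k = 1")
    case True
    then have "?I = {}" by simp
    with Ac[OF kk kk] True show ?thesis by (simp add: quasidet_def C.minus_eq)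
  next
    case False
    then show ?thesis by (simp only: quasidet_def Let_def if_False)
  qed
  obtain x where x: "\<forall>l\<in>{1..k}. x l \<in> carrier R" "\<forall>i\<in>?I. (\<Oplus>\<^bsub>R\<^esub>l\<in>{1..k}. A i l \<otimes>\<^bsub>R\<^esub> x l) = \<zero>\<^bsub>R\<^esub>"
    and xk: "x k = \<one>\<^bsub>R\<^esub>"
    and xq: "(\<Oplus>\<^bsub>R\<^esub>l\<in>{1..k}. A k l \<otimes>\<^bsub>R\<^esub> x l) = quasidet R k A k k"
    by (rule exE[OF C.right_null_vector[OF finite_atLeastAtMost kk Ac inverse, folded quasi]];
        (elim conjE)?; assumption?; rule that)
  note xc = x(1)[THEN bspec] and x0 = x(2)[THEN bspec]
  \<comment> \<open>The null vector indexed by parameters instead of labels, and its extension \<open>v\<close> to the pieces.\<close>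
  define u where "u p = x (the_inv_into {1..k} g p)" for p
  have ug: "u (g l) = x l" if "l \<in> {1..k}" for l
    using that bij_betw_imp_inj_on[OF bij] by (simp add: u_def the_inv_into_f_f)
  have S_eq: "S = g ` {1..k}" using bij by (simp add: bij_betw_def)
  have uc: "u p \<in> carrier R" if "p \<in> S" for p using that xc ug S_eq by auto
  have row: "(\<Oplus>\<^bsub>R\<^esub>q\<in>S. C.M (g i) q \<otimes>\<^bsub>R\<^esub> u q) = (\<Oplus>\<^bsub>R\<^esub>l\<in>{1..k}. A i l \<otimes>\<^bsub>R\<^esub> x l)"
    if i: "i \<in> {1..k}" for i
  proof -
    have "(\<Oplus>\<^bsub>R\<^esub>q\<in>S. C.M (g i) q \<otimes>\<^bsub>R\<^esub> u q) = (\<Oplus>\<^bsub>R\<^esub>l\<in>{1..k}. C.M (g i) (g l) \<otimes>\<^bsub>R\<^esub> u (g l))"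
    proof -
      have "(\<lambda>q. C.M (g i) q \<otimes>\<^bsub>R\<^esub> u q) \<in> g ` {1..k} \<rightarrow> carrier R"
        unfolding S_eq[symmetric] using gS[OF i] uc C.M_closed by blast
      from C.finsum_reindex[OF this bij_betw_imp_inj_on[OF bij]]
      show ?thesis unfolding S_eq[symmetric] .
    qed
    also have "\<dots> = (\<Oplus>\<^bsub>R\<^esub>l\<in>{1..k}. A i l \<otimes>\<^bsub>R\<^esub> x l)"
      using i xc Ac by (intro C.finsum_cong') (auto simp: A ug)
    finally show ?thesis .
  qed
  define v where "v p = u (cyclic_floor S p)" for p
  have vc: "v p \<in> carrier R" for p
    using uc cyclic_floor_in[OF C.fin S_ne] by (simp add: v_def)
  have v_pred: "v (cyclic_pred S' p) = u (cyclic_pred S p)" for p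
    by (simp add: v_def cyclic_floor_pred[OF C'.fin S_sub S_ne])
  have v_row: "(\<Oplus>\<^bsub>R\<^esub>q\<in>S'. C'.M p q \<otimes>\<^bsub>R\<^esub> v q) =
      (if p \<in> S then \<Oplus>\<^bsub>R\<^esub>q\<in>S. C.M p q \<otimes>\<^bsub>R\<^esub> u q else \<zero>\<^bsub>R\<^esub>)" if p: "p \<in> S'" for p
  proof -
    have "(\<Oplus>\<^bsub>R\<^esub>q\<in>S'. C'.M p q \<otimes>\<^bsub>R\<^esub> v q) = v p \<oplus>\<^bsub>R\<^esub> coeff_prev n D p \<otimes>\<^bsub>R\<^esub> u (cyclic_pred S p)
        \<oplus>\<^bsub>R\<^esub> coeff_cross n D p \<otimes>\<^bsub>R\<^esub> u (cyclic_pred S (other_strand D p))"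
      using C'.M_row[OF p vc] by (simp add: v_pred)
    also have "\<dots> = (if p \<in> S then \<Oplus>\<^bsub>R\<^esub>q\<in>S. C.M p q \<otimes>\<^bsub>R\<^esub> u q else \<zero>\<^bsub>R\<^esub>)"
    proof (cases "p \<in> S")
      case True
      then show ?thesis using C.M_row[OF True uc] by (simp add: v_def cyclic_floor_self[OF C.fin])
    next
      case False
      then have "\<not> at_flat D p"
        using p by (auto simp: S_def S'_def vertex_params_def vertices_def preimages_def)
      then have "coeff_prev n D p = \<ominus>\<^bsub>R\<^esub> \<one>\<^bsub>R\<^esub>" "coeff_cross n D p = \<zero>\<^bsub>R\<^esub>"
        by (simp_all add: coeff_prev_def coeff_cross_def R_def)
      moreover have "v p = u (cyclic_pred S p)" by (simp add: v_def cyclic_floor_notin[OF False])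
      moreover have "u (cyclic_pred S q) \<in> carrier R" for q
        using uc cyclic_pred_in[OF C.fin S_ne] by blast
      ultimately show ?thesis using False by (simp add: C.l_minus C.r_neg)
    qed
    finally show ?thesis .
  qed
  have b: "g k \<in> S'" using gS[OF kk] S_sub by blast
  show thesis
  proof (rule that[OF defined b vc, unfolded M'])
    show "v (g k) = \<one>\<^bsub>R\<^esub>"
      using gS[OF kk] by (simp add: v_def cyclic_floor_self[OF C.fin] ug[OF kk] xk)
    show "(\<Oplus>\<^bsub>R\<^esub>q\<in>S'. C'.M (g k) q \<otimes>\<^bsub>R\<^esub> v q) = quasidet R k A k k"
      using v_row[OF b] gS[OF kk] row[OF kk] xq by simp
    fix p assume p: "p \<in> S' - {g k}"
    show "(\<Oplus>\<^bsub>R\<^esub>q\<in>S'. C'.M p q \<otimes>\<^bsub>R\<^esub> v q) = \<zero>\<^bsub>R\<^esub>"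
    proof (cases "p \<in> S")
      case True
      then obtain i where i: "i \<in> {1..k}" "p = g i" unfolding S_eq by blast
      then have "i \<in> ?I" using p by auto
      from x0[OF this] have "(\<Oplus>\<^bsub>R\<^esub>q\<in>S. C.M p q \<otimes>\<^bsub>R\<^esub> u q) = \<zero>\<^bsub>R\<^esub>"
        unfolding i(2) row[OF i(1)] .
      then show ?thesis using v_row[of p] True p by simp
    next
      case False
      then show ?thesis using v_row[of p] p by simp
    qed
  qed
qed

end

theorem claim6p3:
  fixes n :: nat and D :: diagram and F F' :: "plane set" and r r' :: nat
  assumes "flat_virtual_knot_diagram D"
    and "is_fake_vertex_set D F" and "vertices D F \<noteq> {}"
    and "is_fake_vertex_set D F'" and "vertices D F' \<noteq> {}"
  shows "let R = S_ring n;
      k = num_arcs D F; A = coloring_matrix n D F r;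
      k' = num_arcs D F'; A' = coloring_matrix n D F' r'
    in quasidet_defined R k A k k \<and> quasidet_defined R k' A' k' k' \<and>
      (\<exists>U\<in>Units R. \<exists>W\<in>Units R.
        S_proj0 n (U \<otimes>\<^bsub>R\<^esub> W) = \<one>\<^bsub>S_ring 0\<^esub> \<and>
        quasidet R k' A' k' k' = U \<otimes>\<^bsub>R\<^esub> quasidet R k A k k \<otimes>\<^bsub>R\<^esub> W)"
proof -
  interpret flat_diagram D by (rule flat_diagram.intro) (rule assms(1))
  let ?R = "S_ring n" and ?S = "vertex_params D (F \<union> F')"
  have union: "is_fake_vertex_set D (F \<union> F')" "vertices D (F \<union> F') \<noteq> {}"
    using assms(2-5) by (auto simp: is_fake_vertex_set_def vertices_def)
  obtain w where sys: "cyclic_system ?R (t_elt n) (n + 1) ?S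
      (cyclic_pred ?S) (other_strand D) (coeff_prev n D) (coeff_cross n D) w"
    using coloring_system[OF union] by blast
  interpret C: cyclic_system ?R "t_elt n" "n + 1" ?S "cyclic_pred ?S" "other_strand D"
    "coeff_prev n D" "coeff_cross n D" w by (rule sys)
  let ?q = "quasidet ?R (num_arcs D F) (coloring_matrix n D F r) (num_arcs D F) (num_arcs D F)"
  let ?q' = "quasidet ?R (num_arcs D F') (coloring_matrix n D F' r') (num_arcs D F') (num_arcs D F')"
  obtain b x where
    defined: "quasidet_defined ?R (num_arcs D F) (coloring_matrix n D F r) (num_arcs D F) (num_arcs D F)"
    and x: "b \<in> ?S" "\<And>q. q \<in> ?S \<Longrightarrow> x q \<in> carrier ?R" "x b = \<one>\<^bsub>?R\<^esub>"
      "\<And>p. p \<in> ?S - {b} \<Longrightarrow> (\<Oplus>\<^bsub>?R\<^esub>q\<in>?S. C.M p q \<otimes>\<^bsub>?R\<^esub> x q) = \<zero>\<^bsub>?R\<^esub>"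
      "(\<Oplus>\<^bsub>?R\<^esub>q\<in>?S. C.M b q \<otimes>\<^bsub>?R\<^esub> x q) = ?q"
    by (rule quasidet_null_vector[OF assms(2,3) union(1) Un_upper1 sys, where r = r]) (rule that)
  obtain b' x' where
    defined': "quasidet_defined ?R (num_arcs D F') (coloring_matrix n D F' r') (num_arcs D F') (num_arcs D F')"
    and x': "b' \<in> ?S" "\<And>q. q \<in> ?S \<Longrightarrow> x' q \<in> carrier ?R" "x' b' = \<one>\<^bsub>?R\<^esub>"
      "\<And>p. p \<in> ?S - {b'} \<Longrightarrow> (\<Oplus>\<^bsub>?R\<^esub>q\<in>?S. C.M p q \<otimes>\<^bsub>?R\<^esub> x' q) = \<zero>\<^bsub>?R\<^esub>"
      "(\<Oplus>\<^bsub>?R\<^esub>q\<in>?S. C.M b' q \<otimes>\<^bsub>?R\<^esub> x' q) = ?q'"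
    by (rule quasidet_null_vector[OF assms(4,5) union(1) Un_upper2 sys, where r = r']) (rule that)
  obtain U W where UW: "U \<in> Units ?R" "W \<in> Units ?R" "U \<otimes>\<^bsub>?R\<^esub> W \<ominus>\<^bsub>?R\<^esub> \<one>\<^bsub>?R\<^esub> \<in> C.T 1"
    and "?q' = U \<otimes>\<^bsub>?R\<^esub> ?q \<otimes>\<^bsub>?R\<^esub> W"
    using C.null_vector_values_equivalent[OF x(1-4) x'(1-4)] unfolding x(5) x'(5) by blast
  moreover have "S_proj0 n (U \<otimes>\<^bsub>?R\<^esub> W) = \<one>\<^bsub>S_ring 0\<^esub>"
    using UW by (intro S_proj0_eq_one) auto
  ultimately show ?thesis
    using defined defined' unfolding Let_def by blast
qed

end
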